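(* Let $n\geqslant 2$, $\varepsilon>0$, and let $u_0\in\mathcal{C}^2_0(\mathbb{R}^n)$, $u_1\in\mathcal{C}^1_0(\mathbb{R}^n)$ be compactly supported functions with supports contained in $B_R$ for some $R>0$. Assume that $$\int_{\mathbb{R}^n}u_1(x)\,\mathrm{d}x>0.$$ Let $\mu:[0,+\infty)\to[0,+\infty)$ be a modulus of continuity such that: (i) the function $g:\mathbb{R}\to[0,+\infty)$, $g(\tau)=|\tau|^{p_{\mathrm{Gla}}(n)}\mu(|\tau|)$, is convex; (ii) $\mu$ does not satisfy the Dini condition, i.e. $\int_0^{\tau_0}\frac{\mu(\tau)}{\tau}\,\mathrm{d}\tau=+\infty$ for some (and, then, for any) $\tau_0>0$. If $u\in\mathcal{C}^2([0,T_\varepsilon)\times\mathbb{R}^n)$ is a classical local (in time) solution to the semilinear Cauchy problem $$\begin{cases}u_{tt}-\Delta u=|u_t|^{p_{\mathrm{Gla}}(n)}\mu(|u_t|),& x\in\mathbb{R}^n,\ t>0,\\ u(0,x)=\varepsilon u_0(x),\quad u_t(0,x)=\varepsilon u_1(x),& x\in\mathbb{R}^n,\end{cases}$$ where $T_\varepsilon$ denotes its lifespan, then $u$ blows up in finite time, i.e. $T_\varepsilon<+\infty$.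
   Context: The Glassey exponent is $p_{\mathrm{Gla}}(n):=\frac{n+1}{n-1}$ for $n\geqslant 2$. $B_R$ is the ball of $\mathbb{R}^n$ centred at the origin with radius $R$. A modulus of continuity is a continuous, concave and increasing function $\mu:[0,+\infty)\to[0,+\infty)$ with $\mu(0)=0$. The modulus of continuity $\mu$ satisfies the Dini condition if $\int_0^{\tau_0}\frac{\mu(\tau)}{\tau}\,\mathrm{d}\tau<+\infty$ for some (equivalently, for any) $\tau_0>0$. The lifespan $T_\varepsilon$ of a local solution is its maximal existence time. *)

theory Defs
  imports "HOL-Analysis.Analysis"
begin

definition p_Gla :: "nat \<Rightarrow> real" where
  "p_Gla n = (real n + 1) / (real n - 1)"

(* "Increasing" is read in the weak sense, so that moduli of continuity which are
   constant away from the origin are allowed as well. *)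
definition modulus_of_continuity :: "(real \<Rightarrow> real) \<Rightarrow> bool" where
  "modulus_of_continuity \<mu> \<longleftrightarrow>
     (\<forall>\<tau>\<ge>0. 0 \<le> \<mu> \<tau>) \<and> continuous_on {0..} \<mu> \<and> concave_on {0..} \<mu> \<and>
     mono_on {0..} \<mu> \<and> \<mu> 0 = 0"

definition dini_condition :: "(real \<Rightarrow> real) \<Rightarrow> bool" where
  "dini_condition \<mu> \<longleftrightarrow>
     (\<exists>\<tau>\<^sub>0>0. (\<integral>\<^sup>+\<tau>\<in>{0<..\<tau>\<^sub>0}. ennreal (\<mu> \<tau> / \<tau>) \<partial>lborel) < \<infinity>)"

definition glassey_nonlinearity :: "nat \<Rightarrow> (real \<Rightarrow> real) \<Rightarrow> real \<Rightarrow> real" where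
  "glassey_nonlinearity n \<mu> \<tau> = \<bar>\<tau>\<bar> powr p_Gla n * \<mu> \<bar>\<tau>\<bar>"

(* Derivatives are taken within S, so that on a set such as [0,T) x R^n the regularity
   holds up to the boundary t = 0.  On open sets, and on convex sets with nonempty
   interior, the derivative within S is unique. *)
definition C1_on :: "'a::real_normed_vector set \<Rightarrow> ('a \<Rightarrow> 'b::real_normed_vector) \<Rightarrow> bool" where
  "C1_on S f \<longleftrightarrow>
     (\<exists>f' :: 'a \<Rightarrow> 'a \<Rightarrow>\<^sub>L 'b.
        (\<forall>x\<in>S. (f has_derivative blinfun_apply (f' x)) (at x within S)) \<and>
        continuous_on S f')"

definition C2_on :: "'a::real_normed_vector set \<Rightarrow> ('a \<Rightarrow> 'b::real_normed_vector) \<Rightarrow> bool" where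
  "C2_on S f \<longleftrightarrow>
     (\<exists>f' :: 'a \<Rightarrow> 'a \<Rightarrow>\<^sub>L 'b.
        (\<forall>x\<in>S. (f has_derivative blinfun_apply (f' x)) (at x within S)) \<and>
        C1_on S f')"

definition supp :: "('a::topological_space \<Rightarrow> real) \<Rightarrow> 'a set" where
  "supp f = closure (support_on UNIV f)"

(* Functions of (t, x) are curried and only matter for t \<ge> 0; at t = 0 the time derivative
   is the right derivative. *)
definition time_deriv :: "(real \<Rightarrow> 'a \<Rightarrow> real) \<Rightarrow> real \<Rightarrow> 'a \<Rightarrow> real" where
  "time_deriv u t x = vector_derivative (\<lambda>s. u s x) (at t within {0..})"

definition laplacian :: "('a::euclidean_space \<Rightarrow> real) \<Rightarrow> 'a \<Rightarrow> real" where
  "laplacian f x = (\<Sum>i\<in>Basis. (deriv ^^ 2) (\<lambda>h. f (x + h *\<^sub>R i)) 0)"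

(* Classical solution on [0,T) x R^n, with T possibly infinite, of u_tt - Laplace u = F(u_t)
   with data u(0,.) = f, u_t(0,.) = g. *)
definition classical_solution ::
    "(real \<Rightarrow> real) \<Rightarrow> ('a::euclidean_space \<Rightarrow> real) \<Rightarrow> ('a \<Rightarrow> real) \<Rightarrow> ereal
       \<Rightarrow> (real \<Rightarrow> 'a \<Rightarrow> real) \<Rightarrow> bool" where
  "classical_solution F f g T u \<longleftrightarrow>
     0 < T \<and>
     C2_on ({t. 0 \<le> t \<and> ereal t < T} \<times> UNIV) (\<lambda>(t, x). u t x) \<and>
     (\<forall>t x. 0 < t \<and> ereal t < T \<longrightarrow>
        time_deriv (time_deriv u) t x - laplacian (u t) x = F (time_deriv u t x)) \<and>
     (\<forall>x. u 0 x = f x \<and> time_deriv u 0 x = g x)"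

(* T is the maximal existence time of u: u solves the problem on [0,T) and does not extend
   to a classical solution on any longer time interval.  T = \<infinity> means global existence. *)
definition has_lifespan ::
    "(real \<Rightarrow> real) \<Rightarrow> ('a::euclidean_space \<Rightarrow> real) \<Rightarrow> ('a \<Rightarrow> real)
       \<Rightarrow> (real \<Rightarrow> 'a \<Rightarrow> real) \<Rightarrow> ereal \<Rightarrow> bool" where
  "has_lifespan F f g u T \<longleftrightarrow>
     classical_solution F f g T u \<and>
     \<not> (\<exists>T' v. T < T' \<and> classical_solution F f g T' v \<and>
            (\<forall>t x. 0 \<le> t \<and> ereal t < T \<longrightarrow> v t x = u t x))"

end

theory Submission
  imports Defs
begin

text \<open>
  A solution that exists for all times would force \<open>\<mu>\<close> to satisfy the Dini condition.  The
  argument reduces the equation to one space dimension.  Fix a unit coordinate vector \<open>b\<close> and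
  put \<open>F(\<tau>) = \<bar>\<tau>\<bar>\<^sup>p \<mu>(\<bar>\<tau>\<bar>)\<close>, \<open>p = (n + 1) / (n - 1)\<close>.  Averaging \<open>u\<close> over the directions
  orthogonal to \<open>b\<close> removes the transversal part of the Laplacian, since \<open>u\<close> is compactly
  supported in space at each time, and leaves a one-dimensional wave equation with source term
  \<open>\<integral> F(u\<^sub>t)\<close>.  The operator \<open>\<partial>\<^sub>t\<^sup>2 - \<partial>\<^sub>b\<^sup>2\<close> factors as \<open>(\<partial>\<^sub>t + \<partial>\<^sub>b)(\<partial>\<^sub>t - \<partial>\<^sub>b)\<close>, so that
  \<open>y(t) = \<integral> (u\<^sub>t - \<partial>\<^sub>b u)(t, x + t b) dx\<close>, taken over the strip \<open>\<bar>x \<bullet> b\<bar> \<le> R + 1\<close> that moves with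
  the light front, satisfies \<open>y' = \<integral> F(u\<^sub>t) \<ge> 0\<close> and \<open>y(0) = \<epsilon> \<integral> u\<^sub>1 > 0\<close>.

  Following the incoming characteristics back to the initial time, where they lie outside the
  support of the data, gives \<open>\<integral> (u\<^sub>t + \<partial>\<^sub>b u) \<ge> 0\<close> on the same strip, hence \<open>\<integral> u\<^sub>t \<ge> y / 2\<close>
  (\<open>momentum_le_velocity\<close>).  By finite speed of propagation the part of the strip on which \<open>u\<^sub>t\<close>
  may be nonzero has transversal extension of order \<open>\<surd>t\<close>, hence volume
  \<open>A(t) = K t\<^bsup>(n - 1) / 2\<^esup>\<close>, and Jensen's inequality yields \<open>y' \<ge> A F(y / (2 A))\<close>
  (\<open>source_lower_bound\<close>).  The Glassey exponent is exactly the one for which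
  \<open>A\<^bsup>1 - p\<^esup>\<close> is a multiple of \<open>1 / t\<close>, so that with \<open>y \<ge> y(0)\<close>
  it follows that \<open>y' \<ge> c y\<^sup>p \<mu>(k t\<^bsup>-(n - 1) / 2\<^esup>) / t\<close>.
  Therefore \<open>y\<^bsup>1 - p\<^esup>\<close>, which is positive, decreases by at least a multiple of
  \<open>\<integral> \<mu>(k t\<^bsup>-(n - 1) / 2\<^esup>) dt / t\<close>.  The substitution \<open>\<tau> = k t\<^bsup>-(n - 1) / 2\<^esup>\<close> turns this
  integral into a multiple of \<open>\<integral> \<mu>(\<tau>) / \<tau> d\<tau>\<close> near zero, which must then be finite
  (\<open>dini_integral_bound_of_ode\<close>, \<open>dini_condition_of_bounded_integrals\<close>).

  Finite speed of propagation (\<open>finite_speed\<close>) comes from an energy estimate in backward light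
  cones.  All integrations by parts use one fact only: translating a function along a coordinate
  direction does not change its integral (\<open>integral_partial_derivative_eq_0\<close>).
\<close>

section \<open>Integrals over boxes\<close>

text \<open>
  Since \<open>F\<close> vanishes in layers of width one along the two faces orthogonal to \<open>i\<close> and beyond
  them, a translation by \<open>h i\<close> with \<open>\<bar>h\<bar> < 1\<close> does not change its integral over the box.
  Differentiating \<open>h \<mapsto> \<integral> F(x + h i) dx\<close> at \<open>h = 0\<close> under the integral sign gives the result.
  The translation slides the box along its other faces, so that \<open>F\<close> may be arbitrary there; this
  permits integration by parts over a strip in the directions parallel to it.
\<close>
lemma integral_partial_derivative_eq_0:
  fixes F F' :: "'a::euclidean_space \<Rightarrow> real"
  assumes i: "i \<in> Basis"
    and contF: "continuous_on UNIV F" and contF': "continuous_on UNIV F'"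
    and der: "\<And>x. ((\<lambda>h. F (x + h *\<^sub>R i)) has_real_derivative F' x) (at 0)"
    and van: "\<And>x. x \<bullet> i \<le> a \<bullet> i + 1 \<or> b \<bullet> i - 1 \<le> x \<bullet> i \<Longrightarrow> F x = 0"
  shows "integral (cbox a b) F' = 0"
proof -
  let ?G = "\<lambda>h. integral (cbox a b) (\<lambda>x. F (x + h *\<^sub>R i))"
  let ?U = "{-1<..<1::real}"
  have der': "((\<lambda>h. F (x + h *\<^sub>R i)) has_real_derivative F' (x + h *\<^sub>R i)) (at h within ?U)" for x h
  proof -
    have "((\<lambda>k. F ((x + h *\<^sub>R i) + k *\<^sub>R i)) has_real_derivative F' (x + h *\<^sub>R i)) (at 0)"
      by (rule der)
    then have "((\<lambda>k. F (x + (k + h) *\<^sub>R i)) has_real_derivative F' (x + h *\<^sub>R i)) (at 0)"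
      by (simp add: algebra_simps)
    then have "((\<lambda>k. F (x + k *\<^sub>R i)) has_real_derivative F' (x + h *\<^sub>R i)) (at h)"
      using DERIV_shift[of "\<lambda>k. F (x + k *\<^sub>R i)" "F' (x + h *\<^sub>R i)" 0 h] by simp
    then show ?thesis by (rule has_field_derivative_at_within)
  qed
  have G': "(?G has_real_derivative integral (cbox a b) (\<lambda>x. F' (x + 0 *\<^sub>R i))) (at 0 within ?U)"
  proof (rule leibniz_rule_field_derivative)
    show "(\<lambda>x. F (x + h *\<^sub>R i)) integrable_on cbox a b" for h
      by (intro integrable_continuous continuous_intros continuous_on_compose2[OF contF]) auto
    show "continuous_on (?U \<times> cbox a b) (\<lambda>(h, x). F' (x + h *\<^sub>R i))"
      unfolding split_beta
      by (intro continuous_on_compose2[OF contF'] continuous_intros) auto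
  qed (use der' in auto)
  \<comment> \<open>A box that contains all translates under consideration.\<close>
  let ?C = "cbox (a - i) (b + i)"
  have const: "?G h = integral ?C F" if h: "h \<in> ?U" for h
  proof -
    let ?B = "cbox (a + h *\<^sub>R i) (b + h *\<^sub>R i)"
    have coord: "(a + h *\<^sub>R i) \<bullet> j = (if j = i then a \<bullet> i + h else a \<bullet> j)"
       "(b + h *\<^sub>R i) \<bullet> j = (if j = i then b \<bullet> i + h else b \<bullet> j)"
       "(a - i) \<bullet> j = (if j = i then a \<bullet> i - 1 else a \<bullet> j)"
       "(b + i) \<bullet> j = (if j = i then b \<bullet> i + 1 else b \<bullet> j)" if "j \<in> Basis" for j
      using i that by (auto simp: algebra_simps inner_Basis)
    have sub: "?B \<subseteq> ?C"
      using h i by (auto simp: mem_box coord split: if_splits) (smt (verit))+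
    have out: "F x = 0" if "x \<in> ?C" "x \<notin> ?B" for x
    proof -
      obtain j where j: "j \<in> Basis" and *: "\<not> ((a + h *\<^sub>R i) \<bullet> j \<le> x \<bullet> j \<and> x \<bullet> j \<le> (b + h *\<^sub>R i) \<bullet> j)"
        using \<open>x \<notin> ?B\<close> unfolding mem_box by blast
      have **: "(a - i) \<bullet> j \<le> x \<bullet> j \<and> x \<bullet> j \<le> (b + i) \<bullet> j"
        using \<open>x \<in> ?C\<close> j unfolding mem_box by blast
      have "j = i" using * ** coord[OF j] by (auto split: if_splits)
      then show ?thesis using * coord[OF i] h by (intro van) auto
    qed
    have "?G h = integral ?B F"
      using integral_shift_cbox[of "a + h *\<^sub>R i" "h *\<^sub>R i" "b + h *\<^sub>R i" F] by simp
    also have "\<dots> = integral (?B \<inter> ?C) F" using sub by (simp add: Int_absorb2)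
    also have "\<dots> = integral ?C (\<lambda>x. if x \<in> ?B then F x else 0)"
      using integral_restrict_Int[of ?C ?B F] by simp
    also have "\<dots> = integral ?C F"
      by (intro integral_cong) (use out in auto)
    finally show ?thesis .
  qed
  have "(?G has_real_derivative 0) (at 0 within ?U)"
    by (rule has_field_derivative_transform_within[of "\<lambda>_. integral ?C F" _ _ _ 1]) (use const in auto)
  moreover have "at (0::real) within ?U = at 0" by (rule at_within_open) auto
  ultimately show ?thesis
    using G' DERIV_unique by fastforce
qed

lemma has_real_derivative_max_0_power2:
  "((\<lambda>s::real. (max 0 s)\<^sup>2) has_real_derivative 2 * max 0 s) (at s)"
proof -
  consider "s < 0" | "s > 0" | "s = 0" by linarith
  then show ?thesis
  proof cases
    case 1
    have "((\<lambda>_. 0::real) has_real_derivative 0) (at s)" by simp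
    then have "((\<lambda>s. (max 0 s)\<^sup>2) has_real_derivative 0) (at s)"
      by (rule DERIV_cong_ev[THEN iffD1, rotated -1])
         (use 1 eventually_nhds_in_open[of "{..<0}" s] in \<open>auto elim: eventually_mono\<close>)
    then show ?thesis using 1 by simp
  next
    case 2
    have "((\<lambda>s. s\<^sup>2) has_real_derivative 2 * s) (at s)" by (auto intro!: derivative_eq_intros)
    then have "((\<lambda>s. (max 0 s)\<^sup>2) has_real_derivative 2 * s) (at s)"
      by (rule DERIV_cong_ev[THEN iffD1, rotated -1])
         (use 2 eventually_nhds_in_open[of "{0<..}" s] in \<open>auto elim!: eventually_mono\<close>)
    then show ?thesis using 2 by simp
  next
    case 3
    have "((\<lambda>h::real. ((max 0 h)\<^sup>2 - 0) / h) \<longlongrightarrow> 0) (at 0)"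
    proof (rule Lim_null_comparison)
      show "\<forall>\<^sub>F h in at 0. norm (((max 0 h)\<^sup>2 - 0) / h) \<le> \<bar>h::real\<bar>"
        by (auto intro!: always_eventually simp: max_def power2_eq_square)
      show "((\<lambda>h::real. \<bar>h\<bar>) \<longlongrightarrow> 0) (at 0)" by (auto intro!: tendsto_eq_intros)
    qed
    then show ?thesis using 3 by (simp add: DERIV_def)
  qed
qed

text \<open>
  Integrate the inequality between \<open>F\<close> and its supporting line at the mean value of \<open>v\<close>.
\<close>
lemma jensen_integral_cbox:
  fixes F :: "real \<Rightarrow> real" and v :: "'a::euclidean_space \<Rightarrow> real"
  assumes conv: "convex_on UNIV F" and contv: "continuous_on (cbox a b) v"
    and A: "0 < measure lborel (cbox a b)"
  shows "measure lborel (cbox a b) * F (integral (cbox a b) v / measure lborel (cbox a b))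
           \<le> integral (cbox a b) (\<lambda>x. F (v x))"
proof -
  let ?A = "measure lborel (cbox a b)"
  define m where "m = integral (cbox a b) v / ?A"
  define k where "k = Inf ((\<lambda>t. (F m - F t) / (m - t)) ` ({m<..} \<inter> UNIV))"
  have supp: "F m + k * (y - m) \<le> F y" for y
    unfolding k_def using convex_le_Inf_differential[OF conv, of m y] by simp
  have contF: "continuous_on UNIV F" using conv by (intro convex_on_continuous) auto
  have v: "v integrable_on cbox a b" using contv by (rule integrable_continuous)
  have "integral (cbox a b) (\<lambda>x. F m + k * (v x - m)) = ?A * F m + k * (integral (cbox a b) v - ?A * m)"
  proof -
    have "((\<lambda>x. F m + k * (v x - m)) has_integral
        (?A *\<^sub>R F m + k * (integral (cbox a b) v - ?A *\<^sub>R m))) (cbox a b)"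
      by (intro has_integral_add has_integral_mult_right has_integral_diff has_integral_const
            integrable_integral v)
    then show ?thesis by (simp add: integral_unique)
  qed
  also have "\<dots> = ?A * F m" using A by (simp add: m_def)
  finally have "?A * F m = integral (cbox a b) (\<lambda>x. F m + k * (v x - m))" by simp
  also have "\<dots> \<le> integral (cbox a b) (\<lambda>x. F (v x))"
    by (intro integral_le integrable_continuous continuous_intros contv
          continuous_on_compose2[OF contF contv] supp) auto
  finally show ?thesis by (simp add: m_def)
qed

section \<open>A differential inequality and the Dini integral\<close>

text \<open>
  With \<open>N(t) = \<integral> \<mu>(\<tau>) / \<tau> d\<tau>\<close> over \<open>[k t\<^bsup>-\<alpha>\<^esup>, k t\<^sub>1\<^bsup>-\<alpha>\<^esup>]\<close> one has
  \<open>N'(t) = \<alpha> \<mu>(k t\<^bsup>-\<alpha>\<^esup>) / t\<close>.  The differential inequality therefore says that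
  \<open>y\<^bsup>1 - p\<^esup> + (p - 1) (c / \<alpha>) N\<close> does not increase.  Its value at \<open>t\<^sub>1\<close> is at most
  \<open>y\<^sub>0\<^bsup>1 - p\<^esup>\<close>, which bounds \<open>N(T)\<close> independently of \<open>T\<close>.
\<close>
lemma dini_integral_bound_of_ode:
  fixes y y' \<mu> :: "real \<Rightarrow> real"
  assumes p: "p > 1" and c: "c > 0" and k: "k > 0" and \<alpha>: "\<alpha> > 0" and y0: "y0 > 0"
    and t1: "0 < t1" "t1 \<le> T"
    and contmu: "continuous_on {0..} \<mu>"
    and conty: "continuous_on {t1..T} y" and lower: "\<And>t. t \<in> {t1..T} \<Longrightarrow> y0 \<le> y t"
    and der: "\<And>t. t1 < t \<Longrightarrow> t < T \<Longrightarrow> (y has_real_derivative y' t) (at t)"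
    and ineq: "\<And>t. t1 < t \<Longrightarrow> t < T \<Longrightarrow> c * (y t powr p * \<mu> (k * t powr - \<alpha>)) / t \<le> y' t"
  shows "integral {k * T powr - \<alpha>..k * t1 powr - \<alpha>} (\<lambda>\<tau>. \<mu> \<tau> / \<tau>) \<le> \<alpha> / ((p - 1) * c) * y0 powr (1 - p)"
proof -
  let ?s = "\<lambda>t. k * t powr - \<alpha>"
  let ?a = "?s T" and ?b = "?s t1"
  let ?q = "(p - 1) * c / \<alpha>"
  have q: "?q > 0" using p c \<alpha> by simp
  have a0: "?a > 0" using k t1 by simp
  have s_mem: "?s t \<in> {?a..?b}" if "t \<in> {t1..T}" for t
    using that t1 k \<alpha> by (auto intro!: mult_left_mono powr_mono2')
  have s_mem': "?s t \<in> {?a<..<?b}" if "t1 < t" "t < T" for t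
    using that t1 k \<alpha> by (auto intro!: powr_less_mono2_neg)
  have cont_int: "continuous_on {?a..?b} (\<lambda>\<tau>. \<mu> \<tau> / \<tau>)"
    using a0 by (intro continuous_intros continuous_on_subset[OF contmu]) auto
  define N where "N = (\<lambda>x. integral {x..?b} (\<lambda>\<tau>. \<mu> \<tau> / \<tau>))"
  have N': "(N has_real_derivative - (\<mu> x / x)) (at x within {?a..?b})" if "x \<in> {?a..?b}" for x
    unfolding N_def by (rule integral_has_real_derivative'[OF cont_int that])
  have contN: "continuous_on {?a..?b} N"
    using N' by (rule DERIV_continuous_on)
  have ypos: "y t > 0" if "t \<in> {t1..T}" for t using lower[OF that] y0 by simp
  define J where "J = (\<lambda>t. y t powr (1 - p) + ?q * N (?s t))"
  have "J T \<le> J t1"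
  proof (rule DERIV_nonpos_imp_decreasing_open[where f = J and a = t1 and b = T])
    show "t1 \<le> T" by fact
    show "continuous_on {t1..T} J"
      unfolding J_def
      using ypos t1 s_mem
      by (intro continuous_intros conty continuous_on_compose2[OF contN]) (auto simp: less_le)
    fix t assume t: "t1 < t" "t < T"
    have tpos: "t > 0" using t t1 by simp
    have yt: "y t > 0" using ypos t by simp
    have Ns: "(N has_real_derivative - (\<mu> (?s t) / ?s t)) (at (?s t))"
      using N'[of "?s t"] s_mem'[OF t] by (simp add: at_within_Icc_at)
    have s': "(?s has_real_derivative k * (- \<alpha> * t powr (- \<alpha> - 1))) (at t)"
      using tpos by (auto intro!: derivative_eq_intros)
    have NN: "((\<lambda>t. N (?s t)) has_real_derivative - (\<mu> (?s t) / ?s t) * (k * (- \<alpha> * t powr (- \<alpha> - 1)))) (at t)"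
      by (rule DERIV_chain2[OF Ns s'])
    have e1: "- (\<mu> (?s t) / ?s t) * (k * (- \<alpha> * t powr (- \<alpha> - 1))) = \<alpha> * \<mu> (?s t) / t"
      using tpos k by (simp add: powr_diff)
    have yy: "((\<lambda>t. y t powr (1 - p)) has_real_derivative (1 - p) * y t powr (1 - p - 1) * y' t) (at t)"
      using DERIV_fun_powr[OF der[OF t] yt, of "1 - p"] by simp
    have "(J has_real_derivative (1 - p) * y t powr (1 - p - 1) * y' t + ?q * (\<alpha> * \<mu> (?s t) / t)) (at t)"
      unfolding J_def using NN unfolding e1 by (intro DERIV_add yy DERIV_cmult)
    moreover have "(1 - p) * y t powr (1 - p - 1) * y' t + ?q * (\<alpha> * \<mu> (?s t) / t) \<le> 0"
    proof -
      have "(p - 1) * y t powr (- p) * (c * (y t powr p * \<mu> (?s t)) / t) \<le> (p - 1) * y t powr (- p) * y' t"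
        using p by (intro mult_left_mono ineq t) auto
      also have "(p - 1) * y t powr (- p) * (c * (y t powr p * \<mu> (?s t)) / t)
          = (p - 1) * c * (y t powr (- p) * y t powr p) * \<mu> (?s t) / t" by (simp add: mult_ac)
      also have "\<dots> = ?q * (\<alpha> * \<mu> (?s t) / t)"
        using yt \<alpha> by (simp add: powr_add[symmetric])
      finally show ?thesis by (simp add: algebra_simps)
    qed
    ultimately show "\<exists>D. (J has_real_derivative D) (at t) \<and> D \<le> 0" by blast
  qed
  moreover have "?q * N ?a \<le> J T" by (simp add: J_def)
  moreover have "J t1 = y t1 powr (1 - p)" by (simp add: J_def N_def)
  ultimately have "?q * N ?a \<le> y t1 powr (1 - p)" by linarith
  also have "\<dots> \<le> y0 powr (1 - p)"
    using lower[of t1] y0 p t1 by (intro powr_mono2') auto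
  finally have "N ?a \<le> y0 powr (1 - p) / ?q" using q by (simp only: pos_le_divide_eq mult.commute)
  then show ?thesis by (simp add: N_def mult.commute)
qed

lemma dini_condition_of_bounded_integrals:
  fixes \<mu> :: "real \<Rightarrow> real"
  assumes contmu: "continuous_on {0..} \<mu>" and nonneg: "\<And>\<tau>. \<tau> \<ge> 0 \<Longrightarrow> 0 \<le> \<mu> \<tau>"
    and \<tau>0: "\<tau>0 > 0"
    and bound: "\<And>\<delta>. 0 < \<delta> \<Longrightarrow> \<delta> < \<tau>0 \<Longrightarrow> integral {\<delta>..\<tau>0} (\<lambda>\<tau>. \<mu> \<tau> / \<tau>) \<le> C"
  shows "dini_condition \<mu>"
proof -
  define S where "S = (\<lambda>n::nat. {\<tau>0 / (real n + 2)..\<tau>0})"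
  define f where "f = (\<lambda>n \<tau>. ennreal (\<mu> \<tau> / \<tau>) * indicator (S n) \<tau>)"
  have int: "(\<integral>\<^sup>+\<tau>. f n \<tau> \<partial>lborel) \<le> ennreal C" and meas: "f n \<in> borel_measurable lborel" for n
  proof -
    have \<delta>: "0 < \<tau>0 / (real n + 2)" "\<tau>0 / (real n + 2) < \<tau>0" using \<tau>0 by (auto simp: field_simps add_pos_nonneg)
    have cont: "continuous_on (S n) (\<lambda>\<tau>. \<mu> \<tau> / \<tau>)"
      using \<delta> unfolding S_def by (intro continuous_intros continuous_on_subset[OF contmu]) auto
    have "((\<lambda>\<tau>. \<mu> \<tau> / \<tau>) has_integral integral (S n) (\<lambda>\<tau>. \<mu> \<tau> / \<tau>)) (S n)"
      using cont unfolding S_def by (intro integrable_integral integrable_continuous_real)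
    then have "(\<integral>\<^sup>+\<tau>. f n \<tau> \<partial>lborel) = ennreal (integral (S n) (\<lambda>\<tau>. \<mu> \<tau> / \<tau>))"
      unfolding f_def
      by (intro nn_integral_has_integral_lebesgue') (use \<delta> in \<open>auto simp: S_def intro!: divide_nonneg_nonneg nonneg\<close>)
    also have "\<dots> \<le> ennreal C" unfolding S_def using bound[OF \<delta>] by (rule ennreal_leI)
    finally show "(\<integral>\<^sup>+\<tau>. f n \<tau> \<partial>lborel) \<le> ennreal C" .
    have "(\<lambda>\<tau>. indicator (S n) \<tau> *\<^sub>R (\<mu> \<tau> / \<tau>)) \<in> borel_measurable borel"
      using cont by (intro borel_measurable_continuous_on_indicator) (auto simp: S_def)
    then have "(\<lambda>\<tau>. ennreal (indicator (S n) \<tau> *\<^sub>R (\<mu> \<tau> / \<tau>))) \<in> borel_measurable lborel" by simp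
    also have "(\<lambda>\<tau>. ennreal (indicator (S n) \<tau> *\<^sub>R (\<mu> \<tau> / \<tau>))) = f n"
      by (auto simp: f_def indicator_def)
    finally show "f n \<in> borel_measurable lborel" .
  qed
  have "S m \<subseteq> S n" if "m \<le> n" for m n
    using that \<tau>0 by (auto simp: S_def intro!: frac_le elim: order_trans[rotated])
  then have "incseq f"
    unfolding incseq_def f_def le_fun_def by (auto intro!: mult_left_mono simp: indicator_def)
  then have "(\<integral>\<^sup>+\<tau>. (SUP n. f n \<tau>) \<partial>lborel) = (SUP n. \<integral>\<^sup>+\<tau>. f n \<tau> \<partial>lborel)"
    using meas by (rule nn_integral_monotone_convergence_SUP)
  also have "\<dots> \<le> ennreal C" using int by (rule SUP_least)
  finally have 1: "(\<integral>\<^sup>+\<tau>. (SUP n. f n \<tau>) \<partial>lborel) \<le> ennreal C" .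
  have "(\<integral>\<^sup>+\<tau>\<in>{0<..\<tau>0}. ennreal (\<mu> \<tau> / \<tau>) \<partial>lborel) \<le> (\<integral>\<^sup>+\<tau>. (SUP n. f n \<tau>) \<partial>lborel)"
  proof (rule nn_integral_mono)
    fix \<tau> :: real
    show "ennreal (\<mu> \<tau> / \<tau>) * indicator {0<..\<tau>0} \<tau> \<le> (SUP n. f n \<tau>)"
    proof (cases "\<tau> \<in> {0<..\<tau>0}")
      case True
      obtain n :: nat where "\<tau>0 / \<tau> \<le> real n" using real_arch_simple by blast
      then have "\<tau> \<in> S n" using True by (auto simp: S_def field_simps)
      then have "ennreal (\<mu> \<tau> / \<tau>) * indicator {0<..\<tau>0} \<tau> = f n \<tau>" using True by (simp add: f_def)
      then show ?thesis by (simp only:) (rule SUP_upper, simp)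
    qed simp
  qed
  with 1 have "(\<integral>\<^sup>+\<tau>\<in>{0<..\<tau>0}. ennreal (\<mu> \<tau> / \<tau>) \<partial>lborel) \<le> ennreal C" by (rule order_trans[rotated])
  then have "(\<integral>\<^sup>+\<tau>\<in>{0<..\<tau>0}. ennreal (\<mu> \<tau> / \<tau>) \<partial>lborel) < \<infinity>"
    by (simp add: le_less_trans)
  then show ?thesis using \<tau>0 unfolding dini_condition_def by blast
qed

section \<open>Twice differentiable functions on a half-space\<close>

abbreviation half_space :: "(real \<times> 'a::euclidean_space) set" where
  "half_space \<equiv> {0..} \<times> UNIV"

text \<open>
  Makes one-sided time derivatives unique, up to the boundary \<open>t = 0\<close> of the half-space.
\<close>
lemma at_within_atLeast_neq_bot: "a \<le> t \<Longrightarrow> at t within {a..} \<noteq> bot" for a t :: real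
  using islimpt_Icc[of t "t + 1" t] islimpt_subset[of t "{t..t + 1}" "{a..}"]
  by (auto simp: trivial_limit_within)

lemma has_real_derivative_along_curve:
  fixes g :: "'b::real_normed_vector \<Rightarrow> real" and \<gamma> :: "real \<Rightarrow> 'b"
  assumes g: "(g has_derivative g') (at (\<gamma> s) within S)"
    and \<gamma>: "(\<gamma> has_vector_derivative w) (at s within U)" and sub: "\<gamma> ` U \<subseteq> S"
  shows "((\<lambda>s. g (\<gamma> s)) has_real_derivative g' w) (at s within U)"
proof -
  have "((\<lambda>s. g (\<gamma> s)) has_derivative (\<lambda>h. g' (h *\<^sub>R w))) (at s within U)"
    using has_derivative_in_compose[OF \<gamma>[unfolded has_vector_derivative_def]
        has_derivative_subset[OF g sub]] .
  moreover have "(\<lambda>h. g' (h *\<^sub>R w)) = (\<lambda>h. g' w * h)"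
    using linear_cmul[OF has_derivative_linear[OF g]] by (auto simp: mult.commute)
  ultimately show ?thesis by (simp add: has_field_derivative_def)
qed

text \<open>
  Here \<open>d v p\<close> is the derivative of \<open>f\<close> at \<open>p\<close> in direction \<open>v\<close>, and \<open>dd v w p\<close> that of
  \<open>d v\<close> in direction \<open>w\<close>.  Real-valued directional derivatives are used in place of
  operator-valued ones so that they can be integrated and differentiated along curves; the
  time direction is \<open>(1, 0)\<close> and the space directions are \<open>(0, i)\<close>.
\<close>
locale C2_half_space =
  fixes f :: "real \<times> 'a::euclidean_space \<Rightarrow> real"
    and d :: "real \<times> 'a \<Rightarrow> real \<times> 'a \<Rightarrow> real"
    and dd :: "real \<times> 'a \<Rightarrow> real \<times> 'a \<Rightarrow> real \<times> 'a \<Rightarrow> real"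
  assumes has_d: "p \<in> half_space \<Longrightarrow> (f has_derivative (\<lambda>v. d v p)) (at p within half_space)"
    and has_dd: "p \<in> half_space \<Longrightarrow> (d v has_derivative (\<lambda>w. dd v w p)) (at p within half_space)"
    and cont_dd: "continuous_on half_space (dd v w)"
begin

lemma cont_d: "continuous_on half_space (d v)"
  using has_dd by (rule has_derivative_continuous_on)

lemmas continuous_on_d = continuous_on_compose2[OF cont_d]
lemmas continuous_on_dd = continuous_on_compose2[OF cont_dd]

lemma dd_linear: "p \<in> half_space \<Longrightarrow> linear (\<lambda>w. dd v w p)"
  using has_derivative_linear[OF has_dd] .

lemma has_real_derivative_d:
  assumes "(\<gamma> has_vector_derivative w) (at s within U)" "\<gamma> ` U \<subseteq> half_space" "s \<in> U"
  shows "((\<lambda>s. d v (\<gamma> s)) has_real_derivative dd v w (\<gamma> s)) (at s within U)"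
  by (rule has_real_derivative_along_curve[OF has_dd assms(1,2)]) (use assms in blast)

lemma has_real_derivative_f:
  assumes "(\<gamma> has_vector_derivative w) (at s within U)" "\<gamma> ` U \<subseteq> half_space" "s \<in> U"
  shows "((\<lambda>s. f (\<gamma> s)) has_real_derivative d w (\<gamma> s)) (at s within U)"
  by (rule has_real_derivative_along_curve[OF has_d assms(1,2)]) (use assms in blast)

lemma has_real_derivative_d_time:
  assumes "0 \<le> t" "U \<subseteq> {0..}" "t \<in> U"
  shows "((\<lambda>s. d v (s, x)) has_real_derivative dd v (1, 0) (t, x)) (at t within U)"
  by (rule has_real_derivative_d) (use assms in \<open>auto intro!: derivative_eq_intros\<close>)

lemma has_real_derivative_f_time:
  assumes "0 \<le> t" "U \<subseteq> {0..}" "t \<in> U"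
  shows "((\<lambda>s. f (s, x)) has_real_derivative d (1, 0) (t, x)) (at t within U)"
  by (rule has_real_derivative_f) (use assms in \<open>auto intro!: derivative_eq_intros\<close>)

lemma has_real_derivative_d_space:
  assumes "0 \<le> t"
  shows "((\<lambda>h. d v (t, x + h *\<^sub>R i)) has_real_derivative dd v (0, i) (t, x + h *\<^sub>R i)) (at h within U)"
proof -
  have "((\<lambda>h. d v (t, x + h *\<^sub>R i)) has_real_derivative dd v (0, i) (t, x + h *\<^sub>R i)) (at h)"
    by (rule has_real_derivative_d) (use assms in \<open>auto intro!: derivative_eq_intros\<close>)
  then show ?thesis by (rule has_field_derivative_at_within)
qed

lemma has_real_derivative_f_space:
  assumes "0 \<le> t"
  shows "((\<lambda>h. f (t, x + h *\<^sub>R i)) has_real_derivative d (0, i) (t, x + h *\<^sub>R i)) (at h within U)"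
proof -
  have "((\<lambda>h. f (t, x + h *\<^sub>R i)) has_real_derivative d (0, i) (t, x + h *\<^sub>R i)) (at h)"
    by (rule has_real_derivative_f) (use assms in \<open>auto intro!: derivative_eq_intros\<close>)
  then show ?thesis by (rule has_field_derivative_at_within)
qed

text \<open>
  Write the increment \<open>f(r, x + h i) - f(r, x)\<close> as the integral of the space derivative over
  \<open>[0, h]\<close>, differentiate in \<open>r\<close> under the integral sign, and then differentiate in \<open>h\<close> at \<open>0\<close>.
\<close>
lemma mixed_derivatives_commute:
  assumes t: "0 \<le> t"
  shows "dd (1, 0) (0, i) (t, x) = dd (0, i) (1, 0) (t, x)"
proof -
  have diff: "d (1, 0) (t, x + h *\<^sub>R i) - d (1, 0) (t, x)
       = integral {0..h} (\<lambda>s. dd (0, i) (1, 0) (t, x + s *\<^sub>R i))" if h: "0 \<le> h" for h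
  proof -
    have int: "f (r, x + h *\<^sub>R i) - f (r, x) = integral {0..h} (\<lambda>s. d (0, i) (r, x + s *\<^sub>R i))"
      if "r \<in> {0..}" for r
      using fundamental_theorem_of_calculus[OF h, of "\<lambda>s. f (r, x + s *\<^sub>R i)"
          "\<lambda>s. d (0, i) (r, x + s *\<^sub>R i)"] has_real_derivative_f_space that
      by (auto simp: has_real_derivative_iff_has_vector_derivative intro: integral_unique[symmetric])
    have "((\<lambda>r. integral (cbox 0 h) (\<lambda>s. d (0, i) (r, x + s *\<^sub>R i))) has_real_derivative
        integral (cbox 0 h) (\<lambda>s. dd (0, i) (1, 0) (t, x + s *\<^sub>R i))) (at t within {0..})"
    proof (rule leibniz_rule_field_derivative)
      show "((\<lambda>r. d (0, i) (r, x + s *\<^sub>R i)) has_real_derivative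
             dd (0, i) (1, 0) (r, x + s *\<^sub>R i)) (at r within {0..})" if "r \<in> {0..}" for r s
        using that by (intro has_real_derivative_d_time) auto
      show "(\<lambda>s. d (0, i) (r, x + s *\<^sub>R i)) integrable_on cbox 0 h" if "r \<in> {0..}" for r
        using that by (intro integrable_continuous continuous_on_d continuous_intros) auto
      show "continuous_on ({0..} \<times> cbox 0 h) (\<lambda>(r, s). dd (0, i) (1, 0) (r, x + s *\<^sub>R i))"
        unfolding split_beta by (intro continuous_on_dd continuous_intros) auto
    qed (use t in auto)
    then have "((\<lambda>r. f (r, x + h *\<^sub>R i) - f (r, x)) has_real_derivative
        integral {0..h} (\<lambda>s. dd (0, i) (1, 0) (t, x + s *\<^sub>R i))) (at t within {0..})"
      unfolding box_real by (rule has_field_derivative_transform_within[of _ _ _ _ 1]) (use t int in auto)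
    moreover have "((\<lambda>r. f (r, x + h *\<^sub>R i) - f (r, x)) has_real_derivative
        d (1, 0) (t, x + h *\<^sub>R i) - d (1, 0) (t, x)) (at t within {0..})"
      using t by (intro DERIV_diff has_real_derivative_f_time) auto
    ultimately show ?thesis
      using t by (intro vector_derivative_unique_within[of t "{0..}"])
        (auto simp: has_real_derivative_iff_has_vector_derivative
           at_within_atLeast_neq_bot)
  qed
  let ?g = "\<lambda>s. dd (0, i) (1, 0) (t, x + s *\<^sub>R i)"
  have "((\<lambda>h. integral {0..h} ?g) has_real_derivative ?g 0) (at 0 within {0..1})"
    by (rule integral_has_real_derivative)
       (use t in \<open>auto intro!: continuous_on_dd continuous_intros\<close>)
  then have "((\<lambda>h. d (1, 0) (t, x + h *\<^sub>R i) - d (1, 0) (t, x)) has_real_derivative ?g 0) (at 0 within {0..1})"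
    by (rule has_field_derivative_transform_within[of _ _ _ _ 1]) (use diff in auto)
  moreover have "((\<lambda>h. d (1, 0) (t, x + h *\<^sub>R i) - d (1, 0) (t, x)) has_real_derivative
      dd (1, 0) (0, i) (t, x + 0 *\<^sub>R i) - 0) (at 0 within {0..1})"
    using t by (intro DERIV_diff has_real_derivative_d_space DERIV_const)
  ultimately show ?thesis
    using vector_derivative_unique_within_closed_interval[of 0 1 0]
    by (fastforce simp: has_real_derivative_iff_has_vector_derivative)
qed

end

lemma C2_on_half_space_imp:
  assumes "C2_on half_space f"
  shows "\<exists>d dd. C2_half_space f d dd"
proof -
  obtain f' f'' where 1: "\<And>p. p \<in> half_space \<Longrightarrow> (f has_derivative blinfun_apply (f' p)) (at p within half_space)"
    and 2: "\<And>p. p \<in> half_space \<Longrightarrow> (f' has_derivative blinfun_apply (f'' p)) (at p within half_space)"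
    and 3: "continuous_on half_space f''"
    using assms unfolding C2_on_def C1_on_def by blast
  have "C2_half_space f (\<lambda>v p. f' p v) (\<lambda>v w p. f'' p w v)"
  proof
    fix p :: "real \<times> 'a" and v w :: "real \<times> 'a"
    show "continuous_on half_space (\<lambda>p. f'' p w v)"
      by (intro continuous_intros 3)
    assume p: "p \<in> half_space"
    show "(f has_derivative (\<lambda>v. f' p v)) (at p within half_space)" using 1[OF p] .
    show "((\<lambda>p. f' p v) has_derivative (\<lambda>w. f'' p w v)) (at p within half_space)"
      using bounded_linear.has_derivative[OF blinfun.bounded_linear_left 2[OF p]] .
  qed
  then show ?thesis by blast
qed

lemma (in C2_half_space) time_deriv_eq:
  assumes f: "f = (\<lambda>(t, x). u t x)" and t: "0 \<le> t"
  shows "time_deriv u t x = d (1, 0) (t, x)"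
    and "time_deriv (time_deriv u) t x = dd (1, 0) (1, 0) (t, x)"
proof -
  have 1: "time_deriv u t x = d (1, 0) (t, x)" if "0 \<le> t" for t x
    unfolding time_deriv_def
  proof (rule vector_derivative_within[OF at_within_atLeast_neq_bot])
    show "((\<lambda>s. u s x) has_vector_derivative d (1, 0) (t, x)) (at t within {0..})"
      using has_real_derivative_f_time[of t "{0..}" x] that
      by (simp add: f has_real_derivative_iff_has_vector_derivative)
  qed fact
  then show "time_deriv u t x = d (1, 0) (t, x)" using t by simp
  have "time_deriv (time_deriv u) t x = vector_derivative (\<lambda>s. time_deriv u s x) (at t within {0..})"
    by (simp add: time_deriv_def[of "time_deriv u"])
  also have "\<dots> = dd (1, 0) (1, 0) (t, x)"
  proof (rule vector_derivative_within[OF at_within_atLeast_neq_bot[OF t]])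
    have "((\<lambda>s. time_deriv u s x) has_real_derivative dd (1, 0) (1, 0) (t, x)) (at t within {0..})"
      by (rule has_field_derivative_transform_within[OF has_real_derivative_d_time[of t "{0..}" "(1, 0)" x], of 1])
         (use t in \<open>auto simp: 1\<close>)
    then show "((\<lambda>s. time_deriv u s x) has_vector_derivative dd (1, 0) (1, 0) (t, x)) (at t within {0..})"
      by (simp add: has_real_derivative_iff_has_vector_derivative)
  qed
  finally show "time_deriv (time_deriv u) t x = dd (1, 0) (1, 0) (t, x)" .
qed

lemma (in C2_half_space) laplacian_eq:
  assumes f: "f = (\<lambda>(t, x). u t x)" and t: "0 \<le> t"
  shows "laplacian (u t) x = (\<Sum>i\<in>Basis. dd (0, i) (0, i) (t, x))"
  unfolding laplacian_def
proof (rule sum.cong[OF refl])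
  fix i :: 'a
  have "deriv (\<lambda>h. u t (x + h *\<^sub>R i)) = (\<lambda>h. d (0, i) (t, x + h *\<^sub>R i))"
    using has_real_derivative_f_space[OF t, of x i] by (auto simp: f intro!: DERIV_imp_deriv)
  then show "(deriv ^^ 2) (\<lambda>h. u t (x + h *\<^sub>R i)) 0 = dd (0, i) (0, i) (t, x)"
    using has_real_derivative_d_space[OF t, of "(0, i)" x i 0]
    by (simp add: numeral_2_eq_2 DERIV_imp_deriv)
qed

section \<open>Finite speed of propagation\<close>

text \<open>
  A global solution of \<open>f\<^sub>t\<^sub>t - \<Delta>f = F(f\<^sub>t)\<close> with data supported in the ball of radius \<open>R\<close>.  The
  at most linear growth of \<open>F\<close> on bounded sets is what the energy estimate needs in order to
  absorb the source term.
\<close>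
locale wave_solution = C2_half_space f d dd
  for f :: "real \<times> 'a::euclidean_space \<Rightarrow> real" and d dd +
  fixes F :: "real \<Rightarrow> real" and R :: real
  assumes wave: "0 < t \<Longrightarrow> dd (1, 0) (1, 0) (t, x) - (\<Sum>i\<in>Basis. dd (0, i) (0, i) (t, x)) = F (d (1, 0) (t, x))"
    and R_pos: "0 < R"
    and data_t: "R < norm x \<Longrightarrow> d (1, 0) (0, x) = 0"
    and data_f: "R \<le> norm x \<Longrightarrow> f (0, x) = 0"
    and F_nonneg: "0 \<le> F \<tau>"
    and F_convex: "convex_on UNIV F"
    and F_linear_bound: "\<exists>L\<ge>0. \<forall>\<tau>. \<bar>\<tau>\<bar> \<le> m \<longrightarrow> F \<tau> \<le> L * \<bar>\<tau>\<bar>"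
begin

lemma data_x:
  assumes x: "R < norm x" and i: "i \<in> Basis"
  shows "d (0, i) (0, x) = 0"
proof -
  have "((\<lambda>h. f (0, x + h *\<^sub>R i)) has_real_derivative d (0, i) (0, x)) (at 0)"
    using has_real_derivative_f_space[of 0 x i 0] by simp
  moreover have "((\<lambda>h. f (0, x + h *\<^sub>R i)) has_real_derivative 0) (at 0)"
  proof (rule has_field_derivative_transform_within[OF DERIV_const])
    show "0 < norm x - R" using x by simp
    fix h :: real assume "dist h 0 < norm x - R"
    then have "R \<le> norm x - norm (h *\<^sub>R i)" using i by simp
    also have "\<dots> \<le> norm (x + h *\<^sub>R i)" by (rule norm_diff_ineq)
    finally show "0 = f (0, x + h *\<^sub>R i)" by (simp add: data_f)
  qed auto
  ultimately show ?thesis by (rule DERIV_unique)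
qed

lemma F_cont: "continuous_on UNIV F"
  using F_convex by (intro convex_on_continuous) auto

text \<open>
  The flux of the energy through the boundary of the backward cone is outgoing.  Here \<open>a\<close> is
  \<open>f\<^sub>t\<close>, \<open>V\<close> the spatial gradient of \<open>f\<close>, \<open>w\<close> the position relative to the axis of the cone, \<open>r\<close> the
  radius of the cone at the given time and \<open>m\<close> the cut-off, which vanishes outside of the cone.
\<close>
lemma energy_flux_nonpos:
  fixes w V :: 'a and r a m :: real
  assumes "0 \<le> m" and "0 < m \<Longrightarrow> norm w \<le> r"
  shows "8 * m * a * (w \<bullet> V) \<le> 4 * m * r * (a\<^sup>2 + (norm V)\<^sup>2)"
proof (cases "m = 0")
  case False
  with assms have m: "0 < m" and w: "norm w \<le> r" by auto
  have "2 * a * (w \<bullet> V) \<le> 2 * \<bar>a\<bar> * (norm w * norm V)"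
    using Cauchy_Schwarz_ineq2[of w V] abs_le_D1[of "a * (w \<bullet> V)" "\<bar>a\<bar> * (norm w * norm V)"]
    by (auto simp: abs_mult mult_left_mono)
  also have "\<dots> = norm w * (2 * \<bar>a\<bar> * norm V)" by simp
  also have "\<dots> \<le> norm w * (a\<^sup>2 + (norm V)\<^sup>2)"
    using sum_squares_bound[of "\<bar>a\<bar>" "norm V"] by (intro mult_left_mono) auto
  also have "\<dots> \<le> r * (a\<^sup>2 + (norm V)\<^sup>2)"
    using w by (intro mult_right_mono) auto
  finally have "4 * m * (2 * a * (w \<bullet> V)) \<le> 4 * m * (r * (a\<^sup>2 + (norm V)\<^sup>2))"
    using m by (intro mult_left_mono) auto
  then show ?thesis by (simp add: mult_ac)
qed simp

text \<open>
  Let \<open>t\<^sub>0 = \<bar>x\<^sub>0\<bar> - R\<close>, so that the backward cone with apex \<open>(t\<^sub>0, x\<^sub>0)\<close> meets the initial time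
  outside of the support of the data.  The weight
  \<open>\<chi>(s, z) = max(0, (t\<^sub>0 - s)\<^sup>2 - \<bar>z - x\<^sub>0\<bar>\<^sup>2)\<^sup>2\<close> is continuously differentiable and, for
  \<open>s \<le> t\<^sub>0\<close>, vanishes outside of the cone.  Hence the energy
  \<open>E(s) = \<integral> \<chi>(s, z) (f\<^sub>t\<^sup>2 + \<bar>\<nabla>f\<bar>\<^sup>2) dz\<close> is zero for \<open>s = 0\<close>.  Since \<open>\<partial>\<^sub>s\<chi> + \<bar>\<nabla>\<chi>\<bar> \<le> 0\<close> in the cone, an integration
  by parts leaves only the contribution of the source term, so that \<open>E' \<le> 2 L E\<close>, where \<open>L\<close> is a bound
  for \<open>F(\<tau>) / \<bar>\<tau>\<bar>\<close> on the values of \<open>f\<^sub>t\<close> in a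
  bounded region that contains the cone.  By Gronwall's argument \<open>E = 0\<close>, and the weight is positive at
  \<open>(t, x\<^sub>0)\<close>.
\<close>
lemma finite_speed:
  assumes t: "0 \<le> t" and x0: "R + t < norm x0"
  shows "d (1, 0) (t, x0) = 0" and "i \<in> Basis \<Longrightarrow> d (0, i) (t, x0) = 0"
proof -
  define t0 where "t0 = norm x0 - R"
  have t0: "t < t0" using x0 by (simp add: t0_def)
  define a where "a = x0 - (t0 + 1) *\<^sub>R One"
  define b where "b = x0 + (t0 + 1) *\<^sub>R One"
  have x0_mem: "x0 \<in> cbox a b" and ne: "box a b \<noteq> {}"
    using t t0 by (auto simp: a_def b_def mem_box box_ne_empty algebra_simps)
  define q where "q = (\<lambda>s z. (t0 - s)\<^sup>2 - (z - x0) \<bullet> (z - x0))"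
  define m where "m = (\<lambda>s z. max 0 (q s z))"
  define ut where "ut = (\<lambda>s z. d (1, 0) (s, z))"
  define ui where "ui = (\<lambda>i s z. d (0, i) (s, z))"
  define e where "e = (\<lambda>s z. (ut s z)\<^sup>2 + (\<Sum>i\<in>Basis. (ui i s z)\<^sup>2))"
  \<comment> \<open>The weighted energy, its time derivative \<open>G\<close> under the integral sign, and the divergence
     terms \<open>H i = \<partial>\<^sub>i (2 m\<^sup>2 f\<^sub>t \<partial>\<^sub>i f)\<close>, which integrate to zero.\<close>
  define E where "E = (\<lambda>s. integral (cbox a b) (\<lambda>z. (m s z)\<^sup>2 * e s z))"
  define G where "G = (\<lambda>s z. 2 * m s z * (- 2 * (t0 - s)) * e s z + (m s z)\<^sup>2 *
     (2 * ut s z * dd (1, 0) (1, 0) (s, z) + (\<Sum>i\<in>Basis. 2 * ui i s z * dd (0, i) (1, 0) (s, z))))"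
  define H where "H = (\<lambda>i s z. 2 * (2 * m s z * (- 2 * ((z - x0) \<bullet> i)) * (ut s z * ui i s z) + (m s z)\<^sup>2 *
     (dd (1, 0) (0, i) (s, z) * ui i s z + ut s z * dd (0, i) (0, i) (s, z))))"
  have cont_m: "continuous_on S (\<lambda>p. m (g p) (h p))" if "continuous_on S g" "continuous_on S h"
    for S :: "'c::topological_space set" and g h
    unfolding m_def q_def by (intro continuous_intros that)
  have e0: "0 \<le> e s z" for s z unfolding e_def by (intro add_nonneg_nonneg sum_nonneg) auto
  have cont_E: "continuous_on (cbox a b) (\<lambda>z. (m s z)\<^sup>2 * e s z)" if "0 \<le> s" for s
    using that unfolding e_def ut_def ui_def
    by (intro continuous_intros cont_m continuous_on_d) auto
  have E': "(E has_real_derivative integral (cbox a b) (G s)) (at s within {0..t0})" if s: "s \<in> {0..t0}" for s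
    unfolding E_def
  proof (rule leibniz_rule_field_derivative)
    show "(\<lambda>z. (m s z)\<^sup>2 * e s z) integrable_on cbox a b" if "s \<in> {0..t0}" for s
      using that by (intro integrable_continuous cont_E) auto
    show "continuous_on ({0..t0} \<times> cbox a b) (\<lambda>(s, z). G s z)"
      unfolding G_def e_def ut_def ui_def split_beta
      by (intro continuous_intros cont_m continuous_on_d continuous_on_dd) auto
    fix s z assume s: "s \<in> {0..t0}"
    have "((\<lambda>s. (m s z)\<^sup>2) has_real_derivative 2 * m s z * (- 2 * (t0 - s))) (at s within {0..t0})"
      unfolding m_def q_def
      by (rule DERIV_chain2[OF has_real_derivative_max_0_power2]) (auto intro!: derivative_eq_intros)
    moreover have "((\<lambda>s. e s z) has_real_derivative (2 * ut s z * dd (1, 0) (1, 0) (s, z) +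
        (\<Sum>i\<in>Basis. 2 * ui i s z * dd (0, i) (1, 0) (s, z)))) (at s within {0..t0})"
      unfolding e_def ut_def ui_def using s
      by (auto intro!: derivative_eq_intros has_real_derivative_d_time simp: mult_ac)
    ultimately show "((\<lambda>s. (m s z)\<^sup>2 * e s z) has_real_derivative G s z) (at s within {0..t0})"
      unfolding G_def by (rule DERIV_mult'[THEN DERIV_cong]) (simp add: algebra_simps)
  qed (use s in auto)
  have H0: "integral (cbox a b) (H i s) = 0" and contH: "continuous_on UNIV (H i s)"
    if i: "i \<in> Basis" and s: "s \<in> {0..t0}" for i s
  proof -
    show contH: "continuous_on UNIV (H i s)"
      unfolding H_def ut_def ui_def using s
      by (intro continuous_intros cont_m continuous_on_d continuous_on_dd) auto
    show "integral (cbox a b) (H i s) = 0"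
    proof (rule integral_partial_derivative_eq_0[OF i _ contH])
      let ?F = "\<lambda>z. 2 * ((m s z)\<^sup>2 * (ut s z * ui i s z))"
      show "continuous_on UNIV ?F"
        unfolding ut_def ui_def using s
        by (intro continuous_intros cont_m continuous_on_d) auto
      show "?F z = 0" if z: "z \<bullet> i \<le> a \<bullet> i + 1 \<or> b \<bullet> i - 1 \<le> z \<bullet> i" for z
      proof -
        have "t0 \<le> \<bar>(z - x0) \<bullet> i\<bar>" using z i by (auto simp: a_def b_def algebra_simps)
        also have "\<dots> \<le> norm (z - x0)" using i by (rule Basis_le_norm)
        finally have "t0 - s \<le> norm (z - x0)" using s by simp
        then have "(t0 - s)\<^sup>2 \<le> (norm (z - x0))\<^sup>2" using s by (intro power_mono) auto
        then show ?thesis by (simp add: m_def q_def power2_norm_eq_inner)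
      qed
      fix z
      have "((\<lambda>h. (m s (z + h *\<^sub>R i))\<^sup>2) has_real_derivative 2 * m s z * (- 2 * ((z - x0) \<bullet> i))) (at 0)"
        unfolding m_def q_def
        by (rule DERIV_chain2[OF has_real_derivative_max_0_power2, THEN DERIV_cong])
           (auto intro!: derivative_eq_intros simp: inner_commute algebra_simps
              simp: has_real_derivative_iff_has_vector_derivative)
      moreover have "((\<lambda>h. ut s (z + h *\<^sub>R i)) has_real_derivative dd (1, 0) (0, i) (s, z)) (at 0)"
        using has_real_derivative_d_space[of s "(1, 0)" z i 0] s by (simp add: ut_def)
      moreover have "((\<lambda>h. ui i s (z + h *\<^sub>R i)) has_real_derivative dd (0, i) (0, i) (s, z)) (at 0)"
        using has_real_derivative_d_space[of s "(0, i)" z i 0] s by (simp add: ui_def)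
      ultimately show "((\<lambda>h. 2 * ((m s (z + h *\<^sub>R i))\<^sup>2 * (ut s (z + h *\<^sub>R i) * ui i s (z + h *\<^sub>R i))))
          has_real_derivative H i s z) (at 0)"
        unfolding H_def
        by (intro DERIV_cmult) (rule DERIV_mult'[OF _ DERIV_mult', THEN DERIV_cong], auto simp: algebra_simps)
    qed
  qed
  obtain M where M: "\<And>s z. s \<in> {0..t0} \<Longrightarrow> z \<in> cbox a b \<Longrightarrow> \<bar>ut s z\<bar> \<le> M"
  proof -
    have "compact ((\<lambda>p. d (1, 0) p) ` ({0..t0} \<times> cbox a b))"
      by (intro compact_continuous_image continuous_on_subset[OF cont_d] compact_Times compact_cbox) auto
    then obtain M where "\<forall>y\<in>(\<lambda>p. d (1, 0) p) ` ({0..t0} \<times> cbox a b). norm y \<le> M"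
      using compact_imp_bounded bounded_iff by metis
    then show ?thesis by (intro that[of M]) (auto simp: ut_def)
  qed
  obtain L where L0: "0 \<le> L" and L: "\<And>\<tau>. \<bar>\<tau>\<bar> \<le> M \<Longrightarrow> F \<tau> \<le> L * \<bar>\<tau>\<bar>"
    using F_linear_bound[of M] by blast
  have pointwise: "G s z - (\<Sum>i\<in>Basis. H i s z) \<le> 2 * L * ((m s z)\<^sup>2 * e s z)"
    if s: "s \<in> {0<..<t0}" and z: "z \<in> cbox a b" for s z
  proof -
    define V where "V = (\<Sum>i\<in>Basis. ui i s z *\<^sub>R i)"
    have V: "(\<Sum>i\<in>Basis. ((z - x0) \<bullet> i) * ui i s z) = (z - x0) \<bullet> V"
      unfolding V_def by (simp add: inner_sum_right mult.commute)
    have "V \<bullet> i = ui i s z" if "i \<in> Basis" for i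
      using that by (simp add: V_def inner_sum_left_Basis)
    then have e: "e s z = (ut s z)\<^sup>2 + (norm V)\<^sup>2"
      unfolding e_def power2_norm_eq_inner by (subst euclidean_inner) (simp add: power2_eq_square)
    have H: "(\<Sum>i\<in>Basis. H i s z) = - 8 * m s z * ut s z * ((z - x0) \<bullet> V) +
        2 * (m s z)\<^sup>2 * ((\<Sum>i\<in>Basis. ui i s z * dd (0, i) (1, 0) (s, z)) + ut s z * (\<Sum>i\<in>Basis. dd (0, i) (0, i) (s, z)))"
    proof -
      have "H i s z = - 8 * m s z * ut s z * (((z - x0) \<bullet> i) * ui i s z) +
        (2 * (m s z)\<^sup>2 * (ui i s z * dd (0, i) (1, 0) (s, z)) + 2 * (m s z)\<^sup>2 * (ut s z * dd (0, i) (0, i) (s, z)))" for i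
        unfolding H_def using mixed_derivatives_commute[of s i z] s by (simp add: algebra_simps)
      then show ?thesis
        by (simp only: sum.distrib sum_distrib_left[symmetric] V) (simp add: algebra_simps)
    qed
    have tt: "dd (1, 0) (1, 0) (s, z) = F (ut s z) + (\<Sum>i\<in>Basis. dd (0, i) (0, i) (s, z))"
      using wave[of s z] s by (simp add: ut_def)
    have "G s z - (\<Sum>i\<in>Basis. H i s z)
       = (8 * m s z * ut s z * ((z - x0) \<bullet> V) - 4 * m s z * (t0 - s) * e s z) + 2 * (m s z)\<^sup>2 * (ut s z * F (ut s z))"
      unfolding G_def H tt by (simp add: sum_distrib_left[symmetric] mult.assoc) (simp add: algebra_simps)
    also have "\<dots> \<le> 0 + 2 * (m s z)\<^sup>2 * (L * e s z)"
    proof (intro add_mono mult_left_mono)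
      show "8 * m s z * ut s z * ((z - x0) \<bullet> V) - 4 * m s z * (t0 - s) * e s z \<le> 0"
        unfolding e diff_le_0_iff_le
      proof (rule energy_flux_nonpos)
        show "0 \<le> m s z" by (simp add: m_def)
        assume "0 < m s z"
        then have "(norm (z - x0))\<^sup>2 \<le> (t0 - s)\<^sup>2"
          by (auto simp: m_def q_def power2_norm_eq_inner)
        then show "norm (z - x0) \<le> t0 - s" using s by (simp add: power2_le_iff_abs_le abs_le_iff)
      qed
      have "ut s z * F (ut s z) \<le> \<bar>ut s z\<bar> * (L * \<bar>ut s z\<bar>)"
        using F_nonneg[of "ut s z"] L[OF M[OF _ z, of s]] s L0
        by (intro mult_mono) auto
      also have "\<dots> = L * (ut s z)\<^sup>2" by (simp add: power2_eq_square mult_ac)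
      also have "\<dots> \<le> L * e s z" using L0 e by (intro mult_left_mono) auto
      finally show "ut s z * F (ut s z) \<le> L * e s z" .
    qed auto
    finally show ?thesis by (simp add: mult_ac)
  qed
  have growth: "integral (cbox a b) (G s) \<le> 2 * L * E s" if s: "s \<in> {0<..<t0}" for s
  proof -
    have contG: "continuous_on (cbox a b) (G s)"
      unfolding G_def e_def ut_def ui_def using s
      by (intro continuous_intros cont_m continuous_on_d continuous_on_dd) auto
    have intH: "H i s integrable_on cbox a b" if "i \<in> Basis" for i
      using contH[OF that, of s] s by (intro integrable_continuous) (auto intro: continuous_on_subset)
    have "integral (cbox a b) (G s) = integral (cbox a b) (\<lambda>z. G s z - (\<Sum>i\<in>Basis. H i s z))"
      using s H0
      by (subst integral_diff[OF integrable_continuous[OF contG] integrable_sum[OF finite_Basis intH]])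
         (auto simp: integral_sum intH)
    also have "\<dots> \<le> integral (cbox a b) (\<lambda>z. 2 * L * ((m s z)\<^sup>2 * e s z))"
      using s pointwise
      by (intro integral_le[OF integrable_diff[OF integrable_continuous[OF contG] integrable_sum[OF finite_Basis intH]]
            integrable_on_mult_right[OF integrable_continuous[OF cont_E]]]) auto
    also have "\<dots> = 2 * L * E s" by (simp add: E_def)
    finally show ?thesis .
  qed
  have "E t * exp (- 2 * L * t) \<le> E 0 * exp (- 2 * L * 0)"
  proof (rule DERIV_nonpos_imp_decreasing_open[where f = "\<lambda>s. E s * exp (- 2 * L * s)"])
    show "0 \<le> t" by fact
    have "continuous_on {0..t0} E" using E' by (rule DERIV_continuous_on)
    then show "continuous_on {0..t} (\<lambda>s. E s * exp (- 2 * L * s))"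
      using t0 by (intro continuous_intros) (auto intro: continuous_on_subset)
    fix s assume s: "0 < s" "s < t"
    then have "(E has_real_derivative integral (cbox a b) (G s)) (at s)"
      using E'[of s] t0 by (simp add: at_within_Icc_at)
    then have "((\<lambda>s. E s * exp (- 2 * L * s)) has_real_derivative
        (integral (cbox a b) (G s) - 2 * L * E s) * exp (- 2 * L * s)) (at s)"
      by (auto intro!: derivative_eq_intros simp: algebra_simps)
    moreover have "(integral (cbox a b) (G s) - 2 * L * E s) * exp (- 2 * L * s) \<le> 0"
      using growth[of s] s t0 by (auto simp: mult_le_0_iff)
    ultimately show "\<exists>D. ((\<lambda>s. E s * exp (- 2 * L * s)) has_real_derivative D) (at s) \<and> D \<le> 0" by blast
  qed
  moreover have "E 0 = 0"
  proof -
    have "(m 0 z)\<^sup>2 * e 0 z = 0" for z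
    proof (cases "R < norm z")
      case True
      then show ?thesis by (simp add: e_def ut_def ui_def data_t data_x)
    next
      case False
      have "norm x0 \<le> norm (z - x0) + norm z" by (metis add.commute norm_minus_commute norm_triangle_sub)
      with False have "t0 \<le> norm (z - x0)" by (simp add: t0_def)
      then have "t0\<^sup>2 \<le> (norm (z - x0))\<^sup>2" using t t0 by (intro power_mono) auto
      then show ?thesis by (simp add: m_def q_def power2_norm_eq_inner)
    qed
    then show ?thesis unfolding E_def by (simp only: integral_0)
  qed
  ultimately have "E t \<le> 0" by (simp add: mult_le_0_iff)
  moreover have "0 \<le> E t" unfolding E_def using t e0 by (intro integral_nonneg integrable_continuous cont_E) auto
  ultimately have "E t = 0" by simp
  then have "((\<lambda>z. (m t z)\<^sup>2 * e t z) has_integral 0) (cbox a b)"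
    unfolding E_def using integrable_integral[OF integrable_continuous[OF cont_E[OF t]]] by simp
  then have "(m t x0)\<^sup>2 * e t x0 = 0"
    by (intro has_integral_0_cbox_imp_0[OF cont_E[OF t] _ _ ne x0_mem]) (use e0 in auto)
  moreover have "m t x0 > 0" using t0 by (simp add: m_def q_def)
  ultimately have e: "e t x0 = 0" by simp
  have s0: "0 \<le> (\<Sum>i\<in>Basis. (ui i t x0)\<^sup>2)" by (intro sum_nonneg) auto
  then show "d (1, 0) (t, x0) = 0" using e by (simp add: e_def ut_def add_nonneg_eq_0_iff)
  have "(\<Sum>i\<in>Basis. (ui i t x0)\<^sup>2) = 0" using e s0 by (simp add: e_def add_nonneg_eq_0_iff)
  then show "d (0, i) (t, x0) = 0" if "i \<in> Basis"
    using that by (simp add: sum_nonneg_eq_0_iff ui_def)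
qed

end

section \<open>Averages over strips moving with the light front\<close>

text \<open>
  The direction of propagation \<open>b\<close> is singled out, since the thickness of the strip stays bounded
  while its transversal extension has to grow with time.
\<close>
definition slab_corner :: "'a::euclidean_space \<Rightarrow> real \<Rightarrow> real \<Rightarrow> 'a" where
  "slab_corner b \<rho> M = (\<Sum>j\<in>Basis. (if j = b then \<rho> else M) *\<^sub>R j)"

definition slab_box :: "'a::euclidean_space \<Rightarrow> real \<Rightarrow> real \<Rightarrow> 'a set" where
  "slab_box b \<rho> M = cbox (- slab_corner b \<rho> M) (slab_corner b \<rho> M)"

lemma slab_corner_inner:
  "j \<in> Basis \<Longrightarrow> slab_corner b \<rho> M \<bullet> j = (if j = b then \<rho> else M)"
  by (simp add: slab_corner_def)

lemma mem_slab_box: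
  "x \<in> slab_box b \<rho> M \<longleftrightarrow> (\<forall>j\<in>Basis. \<bar>x \<bullet> j\<bar> \<le> (if j = b then \<rho> else M))"
  unfolding slab_box_def mem_box by (intro ball_cong) (auto simp: slab_corner_inner)

lemma slab_box_mono:
  assumes "M' \<le> M"
  shows "slab_box b \<rho> M' \<subseteq> slab_box b \<rho> M"
proof
  fix x assume x: "x \<in> slab_box b \<rho> M'"
  show "x \<in> slab_box b \<rho> M"
    unfolding mem_slab_box
  proof
    fix j :: 'a assume "j \<in> Basis"
    then have "\<bar>x \<bullet> j\<bar> \<le> (if j = b then \<rho> else M')" using x by (simp only: mem_slab_box)
    then show "\<bar>x \<bullet> j\<bar> \<le> (if j = b then \<rho> else M)" using assms by (simp split: if_splits)
  qed
qed

lemma measure_slab_box: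
  fixes b :: "'a::euclidean_space"
  assumes "b \<in> Basis" "0 \<le> \<rho>" "0 \<le> M"
  shows "measure lborel (slab_box b \<rho> M) = 2 * \<rho> * (2 * M) ^ (DIM('a) - 1)"
proof -
  have "measure lborel (slab_box b \<rho> M) = (\<Prod>j\<in>Basis. if j = b then 2 * \<rho> else 2 * M)"
    unfolding slab_box_def using assms
    by (subst content_cbox) (auto simp: slab_corner_inner intro!: prod.cong)
  also have "\<dots> = 2 * \<rho> * (\<Prod>j\<in>Basis - {b}. 2 * M)"
    using assms by (subst prod.remove[of _ b]) (auto intro!: prod.cong)
  also have "\<dots> = 2 * \<rho> * (2 * M) ^ (DIM('a) - 1)"
    using assms by (simp add: card_Diff_singleton)
  finally show ?thesis .
qed

context wave_solution
begin

text \<open>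
  For \<open>\<sigma> = 1\<close> and \<open>\<sigma> = -1\<close> these are the integrals of \<open>f\<^sub>t - \<partial>\<^sub>b f\<close> and \<open>f\<^sub>t + \<partial>\<^sub>b f\<close> over a strip
  that moves with velocity \<open>\<sigma>\<close> along \<open>b\<close> and has offset \<open>c\<close> at time \<open>0\<close>.  The half-width \<open>M\<close> of
  the box is taken so large that the solution does not reach the faces parallel to \<open>b\<close>.
\<close>
definition momentum :: "'a \<Rightarrow> real \<Rightarrow> real \<Rightarrow> real \<Rightarrow> real \<Rightarrow> real" where
  "momentum b M \<sigma> c s = integral (slab_box b (R + 1) M)
     (\<lambda>x. d (1, 0) (s, x + (c + \<sigma> * s) *\<^sub>R b) - \<sigma> * d (0, b) (s, x + (c + \<sigma> * s) *\<^sub>R b))"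

definition source :: "'a \<Rightarrow> real \<Rightarrow> real \<Rightarrow> real \<Rightarrow> real" where
  "source b M r s = integral (slab_box b (R + 1) M) (\<lambda>x. F (d (1, 0) (s, x + r *\<^sub>R b)))"

lemma source_nonneg: "0 \<le> s \<Longrightarrow> 0 \<le> source b M r s"
  unfolding source_def slab_box_def
  by (intro integral_nonneg integrable_continuous continuous_on_compose2[OF F_cont]
        continuous_on_d continuous_intros F_nonneg) auto

lemma transversal_second_derivative_integral:
  assumes i: "i \<in> Basis" "i \<noteq> b" and s: "0 \<le> s" and M: "s + R + 2 \<le> M"  and b: "b \<in> Basis"
  shows "integral (slab_box b \<rho> M) (\<lambda>x. dd (0, i) (0, i) (s, x + r *\<^sub>R b)) = 0"
  unfolding slab_box_def
proof (rule integral_partial_derivative_eq_0[OF i(1)])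
  let ?F = "\<lambda>x. d (0, i) (s, x + r *\<^sub>R b)"
  show "continuous_on UNIV ?F" "continuous_on UNIV (\<lambda>x. dd (0, i) (0, i) (s, x + r *\<^sub>R b))"
    using s by (auto intro!: continuous_on_d continuous_on_dd continuous_intros)
  show "((\<lambda>h. d (0, i) (s, x + h *\<^sub>R i + r *\<^sub>R b)) has_real_derivative
      dd (0, i) (0, i) (s, x + r *\<^sub>R b)) (at 0)" for x
    using has_real_derivative_d_space[OF s, of "(0, i)" "x + r *\<^sub>R b" i 0] by (simp add: algebra_simps)
  show "?F x = 0" if "x \<bullet> i \<le> - slab_corner b \<rho> M \<bullet> i + 1 \<or> slab_corner b \<rho> M \<bullet> i - 1 \<le> x \<bullet> i" for x
  proof (rule finite_speed(2)[OF s _ i(1)])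
    have "R + s < \<bar>x \<bullet> i\<bar>" using that i M R_pos s by (auto simp: slab_corner_inner)
    also have "\<dots> = \<bar>(x + r *\<^sub>R b) \<bullet> i\<bar>" using i b by (simp add: inner_add_left inner_not_same_Basis)
    also have "\<dots> \<le> norm (x + r *\<^sub>R b)" by (rule Basis_le_norm[OF i(1)])
    finally show "R + s < norm (x + r *\<^sub>R b)" .
  qed
qed

text \<open>
  In the coordinates that move with the strip, differentiation in time is the operator
  \<open>\<partial>\<^sub>t + \<sigma> \<partial>\<^sub>b\<close>, and \<open>(\<partial>\<^sub>t + \<sigma> \<partial>\<^sub>b)(\<partial>\<^sub>t - \<sigma> \<partial>\<^sub>b) = \<partial>\<^sub>t\<^sup>2 - \<partial>\<^sub>b\<^sup>2\<close> because \<open>\<sigma>\<^sup>2 = 1\<close>.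
\<close>
lemma momentum_derivative:
  assumes b: "b \<in> Basis" and \<sigma>: "\<sigma> * \<sigma> = 1" and s: "0 \<le> s"
  shows "(momentum b M \<sigma> c has_real_derivative integral (slab_box b (R + 1) M)
      (\<lambda>x. dd (1, 0) (1, 0) (s, x + (c + \<sigma> * s) *\<^sub>R b) - dd (0, b) (0, b) (s, x + (c + \<sigma> * s) *\<^sub>R b)))
      (at s within {0..})"
  unfolding momentum_def slab_box_def
proof (rule leibniz_rule_field_derivative)
  let ?P = "\<lambda>s x. (s, x + (c + \<sigma> * s) *\<^sub>R b)"
  fix s :: real and x :: 'a
  assume s: "s \<in> {0..}"
  have dir: "dd v (1, \<sigma> *\<^sub>R b) (?P s x) = dd v (1, 0) (?P s x) + \<sigma> * dd v (0, b) (?P s x)" for v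
  proof -
    have "(1, \<sigma> *\<^sub>R b) = (1, 0) + \<sigma> *\<^sub>R (0::real, b)" by simp
    then show ?thesis
      using linear_add[OF dd_linear[of "?P s x" v], of "(1, 0)" "\<sigma> *\<^sub>R (0, b)"]
        linear_cmul[OF dd_linear[of "?P s x" v], of \<sigma> "(0, b)"] s
      by simp
  qed
  have *: "((\<lambda>s. d v (?P s x)) has_real_derivative dd v (1, \<sigma> *\<^sub>R b) (?P s x)) (at s within {0..})" for v
    by (rule has_real_derivative_d) (use s in \<open>auto intro!: derivative_eq_intros\<close>)
  have "((\<lambda>s. d (1, 0) (?P s x) - \<sigma> * d (0, b) (?P s x)) has_real_derivative
      dd (1, 0) (1, \<sigma> *\<^sub>R b) (?P s x) - \<sigma> * dd (0, b) (1, \<sigma> *\<^sub>R b) (?P s x)) (at s within {0..})"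
    by (intro DERIV_diff DERIV_cmult *)
  also have "dd (1, 0) (1, \<sigma> *\<^sub>R b) (?P s x) - \<sigma> * dd (0, b) (1, \<sigma> *\<^sub>R b) (?P s x)
      = dd (1, 0) (1, 0) (?P s x) - (\<sigma> * \<sigma>) * dd (0, b) (0, b) (?P s x)"
    unfolding dir using mixed_derivatives_commute[of s b "x + (c + \<sigma> * s) *\<^sub>R b"] s
    by (simp add: algebra_simps)
  finally show "((\<lambda>s. d (1, 0) (?P s x) - \<sigma> * d (0, b) (?P s x)) has_real_derivative
      dd (1, 0) (1, 0) (?P s x) - dd (0, b) (0, b) (?P s x)) (at s within {0..})"
    by (simp add: \<sigma>)
next
  show "(\<lambda>x. d (1, 0) (s, x + (c + \<sigma> * s) *\<^sub>R b) - \<sigma> * d (0, b) (s, x + (c + \<sigma> * s) *\<^sub>R b)) integrable_on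
      cbox (- slab_corner b (R + 1) M) (slab_corner b (R + 1) M)" if "s \<in> {0..}" for s
    using that by (intro integrable_continuous continuous_intros continuous_on_d) auto
  show "continuous_on ({0..} \<times> cbox (- slab_corner b (R + 1) M) (slab_corner b (R + 1) M))
     (\<lambda>(s, x). dd (1, 0) (1, 0) (s, x + (c + \<sigma> * s) *\<^sub>R b) - dd (0, b) (0, b) (s, x + (c + \<sigma> * s) *\<^sub>R b))"
    unfolding split_beta by (intro continuous_intros continuous_on_dd) auto
qed (use s in auto)

text \<open>
  The equation replaces \<open>\<partial>\<^sub>t\<^sup>2 - \<partial>\<^sub>b\<^sup>2\<close> by the source term and the second derivatives in the
  directions orthogonal to \<open>b\<close>; the latter integrate to zero over the strip.
\<close>
lemma momentum_derivative_source:
  assumes b: "b \<in> Basis" and \<sigma>: "\<sigma> * \<sigma> = 1" and s: "0 < s" and M: "s + R + 2 \<le> M"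
  shows "(momentum b M \<sigma> c has_real_derivative source b M (c + \<sigma> * s) s) (at s)"
proof -
  let ?r = "c + \<sigma> * s"
  let ?Q = "slab_box b (R + 1) M"
  have int: "(\<lambda>x. dd (0, i) (0, i) (s, x + ?r *\<^sub>R b)) integrable_on ?Q" for i
    unfolding slab_box_def using s by (intro integrable_continuous continuous_on_dd continuous_intros) auto
  have intF: "(\<lambda>x. F (d (1, 0) (s, x + ?r *\<^sub>R b))) integrable_on ?Q"
    unfolding slab_box_def using s
    by (intro integrable_continuous continuous_on_compose2[OF F_cont] continuous_on_d continuous_intros) auto
  have eq: "dd (1, 0) (1, 0) (s, x + ?r *\<^sub>R b) - dd (0, b) (0, b) (s, x + ?r *\<^sub>R b)
      = F (d (1, 0) (s, x + ?r *\<^sub>R b)) + (\<Sum>i\<in>Basis - {b}. dd (0, i) (0, i) (s, x + ?r *\<^sub>R b))" for x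
    using wave[OF s, of "x + ?r *\<^sub>R b"] b by (simp add: sum.remove[of Basis b])
  have "integral ?Q (\<lambda>x. dd (1, 0) (1, 0) (s, x + ?r *\<^sub>R b) - dd (0, b) (0, b) (s, x + ?r *\<^sub>R b))
      = source b M ?r s + (\<Sum>i\<in>Basis - {b}. integral ?Q (\<lambda>x. dd (0, i) (0, i) (s, x + ?r *\<^sub>R b)))"
    unfolding eq source_def
    by (subst integral_add[OF intF integrable_sum[OF _ int]]) (auto simp: integral_sum int)
  also have "\<dots> = source b M ?r s"
    using s M by (simp add: transversal_second_derivative_integral b)
  finally show ?thesis
    using momentum_derivative[OF b \<sigma>, of s M c] s at_within_interior[of s "{0..}"]
    by (simp only: interior_real_atLeast greaterThan_iff)
qed

lemma momentum_continuous:
  assumes "b \<in> Basis" "\<sigma> * \<sigma> = 1"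
  shows "continuous_on {0..T} (momentum b M \<sigma> c)"
proof (rule continuous_on_subset)
  show "continuous_on {0..} (momentum b M \<sigma> c)"
    by (rule DERIV_continuous_on, rule momentum_derivative) (use assms in auto)
qed auto

lemma momentum_mono:
  assumes b: "b \<in> Basis" and \<sigma>: "\<sigma> * \<sigma> = 1" and t: "0 \<le> t" and M: "t + R + 2 \<le> M"
  shows "momentum b M \<sigma> c 0 \<le> momentum b M \<sigma> c t"
proof (rule DERIV_nonneg_imp_increasing_open[where f = "momentum b M \<sigma> c"])
  fix s assume s: "0 < s" "s < t"
  have "(momentum b M \<sigma> c has_real_derivative source b M (c + \<sigma> * s) s) (at s)"
    using s M by (intro momentum_derivative_source b \<sigma>) auto
  then show "\<exists>D. (momentum b M \<sigma> c has_real_derivative D) (at s) \<and> 0 \<le> D"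
    using source_nonneg s by fastforce
qed (use t momentum_continuous[OF b \<sigma>] in auto)

text \<open>
  The strip that moves with velocity \<open>-1\<close> and coincides with the outgoing one at time \<open>t\<close> starts
  at offset \<open>2 t\<close>.  For \<open>t \<ge> R + 1\<close> it lies outside of the support of the data initially, so the
  integral of \<open>f\<^sub>t + \<partial>\<^sub>b f\<close> over it starts from \<open>0\<close> and stays nonnegative.  Adding it to the
  integral of \<open>f\<^sub>t - \<partial>\<^sub>b f\<close> leaves \<open>2 \<integral> f\<^sub>t\<close>.
\<close>
lemma momentum_le_velocity:
  assumes b: "b \<in> Basis" and t: "R + 1 \<le> t" and M: "t + R + 2 \<le> M"
  shows "momentum b M 1 0 t \<le> 2 * integral (slab_box b (R + 1) M) (\<lambda>x. d (1, 0) (t, x + t *\<^sub>R b))"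
proof -
  have t0: "0 \<le> t" using t R_pos by simp
  let ?Q = "slab_box b (R + 1) M"
  have far: "R < norm (x + (2 * t) *\<^sub>R b)" if "x \<in> ?Q" for x
  proof -
    have "\<bar>x \<bullet> b\<bar> \<le> R + 1" using that b by (auto simp: mem_slab_box)
    then have "R < \<bar>(x + (2 * t) *\<^sub>R b) \<bullet> b\<bar>" using b t R_pos by (simp add: inner_add_left)
    also have "\<dots> \<le> norm (x + (2 * t) *\<^sub>R b)" by (rule Basis_le_norm[OF b])
    finally show ?thesis .
  qed
  have "momentum b M (-1) (2 * t) 0 = integral ?Q (\<lambda>_. 0)"
    unfolding momentum_def by (rule integral_cong) (simp add: data_t data_x b far)
  then have "0 \<le> momentum b M (-1) (2 * t) t"
    using momentum_mono[OF b, of "-1" t M "2 * t"] t0 M by simp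
  moreover have int: "(\<lambda>x. d v (t, x + t *\<^sub>R b)) integrable_on ?Q" for v
    unfolding slab_box_def using t0 by (intro integrable_continuous continuous_on_d continuous_intros) auto
  ultimately show ?thesis
    using integral_diff[OF int[of "(1, 0)"] int[of "(0, b)"]] integral_add[OF int[of "(1, 0)"] int[of "(0, b)"]]
    by (simp add: momentum_def)
qed

text \<open>
  With \<open>\<rho> = R + 1\<close>, a point of the strip at time \<open>t\<close> has \<open>b\<close>-coordinate at least \<open>t - \<rho>\<close>, and the
  identity \<open>(t + \<rho>)\<^sup>2 = (t - \<rho>)\<^sup>2 + 4 t \<rho>\<close> shows that it is outside of the ball of radius
  \<open>t + \<rho>\<close> once another coordinate exceeds \<open>2 \<surd>(t \<rho>)\<close>.
\<close>
lemma velocity_zero_outside_paraboloid: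
  assumes b: "b \<in> Basis" and t: "R + 1 \<le> t"
    and x: "x \<in> slab_box b (R + 1) M" "x \<notin> slab_box b (R + 1) (2 * sqrt (t * (R + 1)))"
  shows "d (1, 0) (t, x + t *\<^sub>R b) = 0"
proof (rule finite_speed(1))
  let ?z = "x + t *\<^sub>R b"
  let ?\<rho> = "R + 1"
  show "0 \<le> t" using t R_pos by simp
  obtain j where j: "j \<in> Basis" "j \<noteq> b" "2 * sqrt (t * ?\<rho>) < \<bar>x \<bullet> j\<bar>"
    using x by (auto simp: mem_slab_box split: if_splits)
  have xb: "\<bar>x \<bullet> b\<bar> \<le> ?\<rho>" using x b by (auto simp: mem_slab_box)
  have zb: "?z \<bullet> b = x \<bullet> b + t" and zj: "?z \<bullet> j = x \<bullet> j"
    using b j by (auto simp: inner_add_left inner_not_same_Basis)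
  have "(t + ?\<rho>)\<^sup>2 = (t - ?\<rho>)\<^sup>2 + (2 * sqrt (t * ?\<rho>))\<^sup>2"
    using t R_pos by (simp add: power2_eq_square algebra_simps real_sqrt_mult_self)
  also have "\<dots> \<le> (?z \<bullet> b)\<^sup>2 + (?z \<bullet> j)\<^sup>2"
  proof (rule add_mono)
    show "(t - ?\<rho>)\<^sup>2 \<le> (?z \<bullet> b)\<^sup>2" unfolding zb using xb t by (intro power_mono) auto
    show "(2 * sqrt (t * ?\<rho>))\<^sup>2 \<le> (?z \<bullet> j)\<^sup>2" unfolding zj power2_abs[symmetric, of "x \<bullet> j"]
      using j(3) t R_pos by (intro power_mono) auto
  qed
  also have "\<dots> = (\<Sum>i\<in>{b, j}. (?z \<bullet> i)\<^sup>2)" using j by simp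
  also have "\<dots> \<le> (\<Sum>i\<in>Basis. (?z \<bullet> i)\<^sup>2)" using b j by (intro sum_mono2) auto
  also have "\<dots> = (norm ?z)\<^sup>2"
    unfolding power2_norm_eq_inner by (subst euclidean_inner) (simp add: power2_eq_square)
  finally have "t + ?\<rho> \<le> norm ?z" by (rule power2_le_imp_le) simp
  then show "R + t < norm ?z" by simp
qed

text \<open>
  Jensen's inequality is applied on the smaller box that carries all of \<open>f\<^sub>t\<close>; its volume \<open>A\<close> grows
  only like \<open>t\<^bsup>(n - 1) / 2\<^esup>\<close>.
\<close>
lemma source_lower_bound:
  assumes b: "b \<in> Basis" and t: "R + 1 \<le> t" and M: "t + R + 2 \<le> M"
    and A: "A = 2 * (R + 1) * (4 * sqrt (t * (R + 1))) ^ (DIM('a) - 1)"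
  shows "A * F (integral (slab_box b (R + 1) M) (\<lambda>x. d (1, 0) (t, x + t *\<^sub>R b)) / A) \<le> source b M t t"
proof -
  let ?Q = "slab_box b (R + 1) M"
  let ?B = "slab_box b (R + 1) (2 * sqrt (t * (R + 1)))"
  let ?v = "\<lambda>x. d (1, 0) (t, x + t *\<^sub>R b)"
  have t0: "0 < t" using t R_pos by simp
  have contv: "continuous_on S ?v" for S
    using t0 by (intro continuous_on_d continuous_intros) auto
  have contF: "continuous_on S (\<lambda>x. F (?v x))" for S
    by (rule continuous_on_compose2[OF F_cont contv]) auto
  have mB: "measure lborel ?B = A"
    using b t0 R_pos by (simp add: measure_slab_box A)
  have A0: "0 < A" using t0 R_pos by (simp add: A)
  have "2 * sqrt (t * (R + 1)) \<le> t + (R + 1)"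
    using arith_geo_mean_sqrt[of t "R + 1"] t0 R_pos by simp
  then have "2 * sqrt (t * (R + 1)) \<le> M" using M by simp
  then have sub: "?B \<subseteq> ?Q" by (intro slab_box_mono)
  have "integral ?B ?v = integral (?B \<inter> ?Q) ?v" using sub by (simp add: Int_absorb2)
  also have "\<dots> = integral ?Q (\<lambda>x. if x \<in> ?B then ?v x else 0)"
    using integral_restrict_Int[of ?Q ?B ?v] by simp
  also have "\<dots> = integral ?Q ?v"
    using velocity_zero_outside_paraboloid[OF b t] by (intro integral_cong) auto
  finally have "integral ?B ?v = integral ?Q ?v" .
  then have "A * F (integral ?Q ?v / A) \<le> integral ?B (\<lambda>x. F (?v x))"
    using jensen_integral_cbox[OF F_convex contv, of "- slab_corner b (R + 1) (2 * sqrt (t * (R + 1)))"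
        "slab_corner b (R + 1) (2 * sqrt (t * (R + 1)))"] mB A0
    by (simp add: slab_box_def)
  also have "\<dots> \<le> integral ?Q (\<lambda>x. F (?v x))"
    using sub unfolding slab_box_def
    by (intro integral_subset_le integrable_continuous contF) (auto simp: F_nonneg)
  finally show ?thesis by (simp add: source_def)
qed

text \<open>
  The term \<open>\<partial>\<^sub>b f\<close> drops out because \<open>f(0, \<cdot>)\<close> vanishes near the faces of the strip; the
  half-width \<open>R + 1\<close> of the strip leaves just the margin needed for this.
\<close>
lemma initial_momentum:
  assumes b: "b \<in> Basis" and M: "R \<le> M"
    and I: "((\<lambda>x. d (1, 0) (0, x)) has_integral I) UNIV"
  shows "momentum b M 1 0 0 = I"
proof -
  let ?Q = "slab_box b (R + 1) M"
  have int: "(\<lambda>x. d v (0, x)) integrable_on ?Q" for v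
    unfolding slab_box_def by (intro integrable_continuous continuous_on_d continuous_intros) auto
  have "x \<in> ?Q" if "norm x \<le> R" for x
    unfolding mem_slab_box
  proof
    fix j :: 'a assume "j \<in> Basis"
    then have "\<bar>x \<bullet> j\<bar> \<le> norm x" by (rule Basis_le_norm)
    then show "\<bar>x \<bullet> j\<bar> \<le> (if j = b then R + 1 else M)" using that M by (cases "j = b") auto
  qed
  then have "d (1, 0) (0, x) = 0" if "x \<notin> ?Q" for x
    using that data_t[of x] not_less by blast
  then have "(\<lambda>x. if x \<in> ?Q then d (1, 0) (0, x) else 0) = (\<lambda>x. d (1, 0) (0, x))" by auto
  then have 1: "((\<lambda>x. d (1, 0) (0, x)) has_integral I) ?Q"
    using I has_integral_restrict_UNIV[of ?Q "\<lambda>x. d (1, 0) (0, x)" I] by simp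
  have 2: "integral ?Q (\<lambda>x. d (0, b) (0, x)) = 0"
    unfolding slab_box_def
  proof (rule integral_partial_derivative_eq_0[OF b])
    have "continuous_on half_space f" using has_d by (rule has_derivative_continuous_on)
    then show "continuous_on UNIV (\<lambda>x. f (0, x))"
      by (rule continuous_on_compose2) (auto intro!: continuous_intros)
    show "continuous_on UNIV (\<lambda>x. d (0, b) (0, x))"
      by (intro continuous_on_d continuous_intros) auto
    show "((\<lambda>h. f (0, x + h *\<^sub>R b)) has_real_derivative d (0, b) (0, x)) (at 0)" for x
      using has_real_derivative_f_space[of 0 x b 0] by simp
    show "f (0, x) = 0" if "x \<bullet> b \<le> - slab_corner b (R + 1) M \<bullet> b + 1 \<or> slab_corner b (R + 1) M \<bullet> b - 1 \<le> x \<bullet> b" for x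
    proof (rule data_f)
      have "R \<le> \<bar>x \<bullet> b\<bar>" using that b by (auto simp: slab_corner_inner)
      then show "R \<le> norm x" using Basis_le_norm[OF b, of x] by simp
    qed
  qed
  show ?thesis
    using integral_diff[OF int[of "(1, 0)"] int[of "(0, b)"]] integral_unique[OF 1] 2
    by (simp add: momentum_def)
qed

end

section \<open>The Glassey nonlinearity\<close>

lemma glassey_nonneg:
  assumes "modulus_of_continuity \<mu>"
  shows "0 \<le> glassey_nonlinearity n \<mu> \<tau>"
  using assms by (simp add: glassey_nonlinearity_def modulus_of_continuity_def)

lemma glassey_linear_bound:
  assumes mu: "modulus_of_continuity \<mu>" and n: "2 \<le> n"
  shows "\<exists>L\<ge>0. \<forall>\<tau>. \<bar>\<tau>\<bar> \<le> m \<longrightarrow> glassey_nonlinearity n \<mu> \<tau> \<le> L * \<bar>\<tau>\<bar>"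
proof (intro exI conjI allI impI)
  let ?p = "p_Gla n"
  have mono: "\<And>a b. 0 \<le> a \<Longrightarrow> a \<le> b \<Longrightarrow> \<mu> a \<le> \<mu> b" and pos: "\<And>a. 0 \<le> a \<Longrightarrow> 0 \<le> \<mu> a"
    using mu by (auto simp: modulus_of_continuity_def mono_on_def)
  have p: "1 \<le> ?p" using n by (simp add: p_Gla_def)
  show "0 \<le> \<bar>m\<bar> powr (?p - 1) * \<mu> \<bar>m\<bar>" using pos by simp
  fix \<tau> :: real assume \<tau>: "\<bar>\<tau>\<bar> \<le> m"
  have "glassey_nonlinearity n \<mu> \<tau> = \<bar>\<tau>\<bar> * (\<bar>\<tau>\<bar> powr (?p - 1) * \<mu> \<bar>\<tau>\<bar>)"
    using powr_mult_base[of "\<bar>\<tau>\<bar>" "?p - 1"] by (simp add: glassey_nonlinearity_def mult.assoc[symmetric])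
  also have "\<dots> \<le> \<bar>\<tau>\<bar> * (\<bar>m\<bar> powr (?p - 1) * \<mu> \<bar>m\<bar>)"
    using \<tau> p pos by (intro mult_left_mono mult_mono powr_mono2 mono) auto
  finally show "glassey_nonlinearity n \<mu> \<tau> \<le> \<bar>m\<bar> powr (?p - 1) * \<mu> \<bar>m\<bar> * \<bar>\<tau>\<bar>" by (simp add: mult_ac)
qed

text \<open>
  This is where the Glassey exponent enters: \<open>(n - 1) / 2 \<cdot> (1 - p) = -1\<close>, so that the factor
  \<open>A\<^bsup>1 - p\<^esup>\<close> is a multiple of \<open>1 / t\<close>.  The power of \<open>y\<close> is kept, since it produces the blow-up; in the
  argument of \<open>\<mu>\<close> the constant lower bound \<open>y\<^sub>0\<close> suffices.
\<close>
lemma glassey_lower_bound: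
  assumes mu: "modulus_of_continuity \<mu>" and n: "2 \<le> n"
    and K: "0 < K" and t: "0 < t" and y: "0 < y0" "y0 \<le> y" "y / 2 \<le> m"
    and A: "A = K * t powr ((real n - 1) / 2)"
  shows "(1 / 2) powr p_Gla n * K powr (1 - p_Gla n) *
           (y powr p_Gla n * \<mu> (y0 / (2 * K) * t powr - ((real n - 1) / 2))) / t
         \<le> A * glassey_nonlinearity n \<mu> (m / A)"
proof -
  let ?p = "p_Gla n" and ?\<beta> = "(real n - 1) / 2"
  have mono: "\<And>a b. 0 \<le> a \<Longrightarrow> a \<le> b \<Longrightarrow> \<mu> a \<le> \<mu> b" and pos: "\<And>a. 0 \<le> a \<Longrightarrow> 0 \<le> \<mu> a"
    using mu by (auto simp: modulus_of_continuity_def mono_on_def)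
  have p: "0 < ?p" and scale: "?\<beta> * (1 - ?p) = - 1"
    using n by (auto simp: p_Gla_def field_simps)
  have A0: "0 < A" using K t by (simp add: A)
  have "A powr (1 - ?p) = K powr (1 - ?p) * t powr (?\<beta> * (1 - ?p))"
    using K t by (simp add: A powr_mult powr_powr)
  also have "\<dots> = K powr (1 - ?p) / t"
    unfolding scale using t by (simp add: powr_minus divide_inverse)
  finally have Ap: "A powr (1 - ?p) = K powr (1 - ?p) / t" .
  have arg: "y0 / (2 * K) * t powr - ?\<beta> = y0 / 2 / A"
    using K t by (simp add: A powr_minus field_simps)
  have "A * ((y / 2 / A) powr ?p * \<mu> (y0 / 2 / A)) \<le> A * ((m / A) powr ?p * \<mu> (m / A))"
    using A0 y p pos by (intro mult_left_mono mult_mono powr_mono2 mono divide_right_mono) auto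
  also have "\<dots> = A * glassey_nonlinearity n \<mu> (m / A)"
    using A0 y by (simp add: glassey_nonlinearity_def)
  also have "A * ((y / 2 / A) powr ?p * \<mu> (y0 / 2 / A))
      = (1 / 2) powr ?p * (A * A powr (- ?p)) * (y powr ?p * \<mu> (y0 / 2 / A))"
    using A0 y by (simp add: powr_divide powr_minus_divide powr_mult)
  also have "A * A powr (- ?p) = K powr (1 - ?p) / t"
    using A0 Ap powr_mult_base[of A "- ?p"] by simp
  finally show ?thesis unfolding arg by simp
qed

section \<open>Blow-up in finite time\<close>

text \<open>
  The half-width \<open>M\<close> of the box depends on the final time \<open>T\<close>, and so does \<open>y\<close> as a function.
  The lower bound \<open>I\<close> for \<open>y\<close> and the constants \<open>c\<close>, \<open>k\<close> do not depend on \<open>T\<close>, so letting \<open>T\<close> tend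
  to infinity bounds the integrals of \<open>\<mu>(\<tau>) / \<tau>\<close> down to zero.
\<close>
lemma (in wave_solution) dini_condition_of_global_solution:
  assumes n: "2 \<le> DIM('a)" and mu: "modulus_of_continuity \<mu>"
    and F: "F = glassey_nonlinearity DIM('a) \<mu>"
    and I: "((\<lambda>x. d (1, 0) (0, x)) has_integral I) UNIV" "0 < I"
  shows "dini_condition \<mu>"
proof -
  obtain b :: 'a where b: "b \<in> Basis" using nonempty_Basis by blast
  let ?n = "DIM('a)" and ?\<rho> = "R + 1"
  let ?p = "p_Gla ?n" and ?\<beta> = "(real ?n - 1) / 2"
  define K where "K = 2 * ?\<rho> * (4 * sqrt ?\<rho>) ^ (?n - 1)"
  define k where "k = I / (2 * K)"
  define c where "c = (1 / 2) powr ?p * K powr (1 - ?p)"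
  have \<rho>: "0 < ?\<rho>" using R_pos by simp
  have K: "0 < K" using R_pos by (simp add: K_def)
  have k: "0 < k" using K I by (simp add: k_def)
  have c: "0 < c" using K by (simp add: c_def)
  have \<beta>: "0 < ?\<beta>" using n by simp
  have p: "1 < ?p" using n by (simp add: p_Gla_def)
  have contmu: "continuous_on {0..} \<mu>" and pos: "\<And>\<tau>. 0 \<le> \<tau> \<Longrightarrow> 0 \<le> \<mu> \<tau>"
    using mu by (auto simp: modulus_of_continuity_def)
  have area: "2 * ?\<rho> * (4 * sqrt (t * ?\<rho>)) ^ (?n - 1) = K * t powr ?\<beta>" if "0 < t" for t
  proof -
    have "sqrt t ^ (?n - 1) = (t powr (1 / 2)) powr real (?n - 1)"
      using that by (subst powr_realpow[symmetric]) (auto simp: powr_half_sqrt)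
    also have "\<dots> = t powr ?\<beta>" using n by (simp add: powr_powr of_nat_diff)
    finally show ?thesis by (simp add: K_def real_sqrt_mult power_mult_distrib)
  qed
  have bound: "integral {k * T powr - ?\<beta>..k * ?\<rho> powr - ?\<beta>} (\<lambda>\<tau>. \<mu> \<tau> / \<tau>)
      \<le> ?\<beta> / ((?p - 1) * c) * I powr (1 - ?p)" if T: "?\<rho> \<le> T" for T
  proof (rule dini_integral_bound_of_ode[OF p c k \<beta> I(2) \<rho> T contmu])
    define M where "M = T + R + 2"
    let ?y = "momentum b M 1 0"
    have y_I: "I \<le> ?y t" if "t \<in> {?\<rho>..T}" for t
      using momentum_mono[OF b, of 1 t M 0] initial_momentum[OF b _ I(1), of M] that T \<rho> by (simp add: M_def)
    then show "\<And>t. t \<in> {?\<rho>..T} \<Longrightarrow> I \<le> ?y t" .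
    show "continuous_on {?\<rho>..T} ?y"
      by (rule continuous_on_subset[OF momentum_continuous[OF b, of 1 T]]) (use \<rho> in auto)
    fix t assume t: "?\<rho> < t" "t < T"
    have t0: "0 < t" using t \<rho> by simp
    show "(?y has_real_derivative source b M t t) (at t)"
      using momentum_derivative_source[OF b, of 1 t M 0] t t0 by (simp add: M_def)
    let ?A = "2 * ?\<rho> * (4 * sqrt (t * ?\<rho>)) ^ (?n - 1)"
    let ?m = "integral (slab_box b ?\<rho> M) (\<lambda>x. d (1, 0) (t, x + t *\<^sub>R b))"
    have "?y t / 2 \<le> ?m"
      using momentum_le_velocity[OF b, of t M] t by (simp add: M_def)
    then have "c * (?y t powr ?p * \<mu> (k * t powr - ?\<beta>)) / t \<le> ?A * F (?m / ?A)"
      unfolding c_def k_def F using y_I[of t] t I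
      by (intro glassey_lower_bound mu n K t0 area) auto
    also have "\<dots> \<le> source b M t t"
      using t by (intro source_lower_bound[OF b]) (auto simp: M_def)
    finally show "c * (?y t powr ?p * \<mu> (k * t powr - ?\<beta>)) / t \<le> source b M t t" .
  qed
  show ?thesis
  proof (rule dini_condition_of_bounded_integrals[OF contmu pos])
    show "0 < k * ?\<rho> powr - ?\<beta>" using k \<rho> by simp
    fix \<delta> assume \<delta>: "0 < \<delta>" "\<delta> < k * ?\<rho> powr - ?\<beta>"
    \<comment> \<open>The time at which the argument \<open>k T\<^bsup>-\<beta>\<^esup>\<close> of the modulus has decreased to \<open>\<delta>\<close>.\<close>
    define T where "T = (\<delta> / k) powr (- (1 / ?\<beta>))"
    have "- (1 / x) * - x = 1" "- x * - (1 / x) = 1" if "0 < x" for x :: real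
      using that by simp_all
    note inv = this[OF \<beta>]
    have "(\<delta> / k) powr (- (1 / ?\<beta>) * - ?\<beta>) = \<delta> / k"
      using \<delta> k by (simp only: inv) simp
    then have T\<delta>: "k * T powr - ?\<beta> = \<delta>" using k by (simp only: T_def powr_powr) simp
    have "?\<rho> = (?\<rho> powr - ?\<beta>) powr (- (1 / ?\<beta>))"
      using \<rho> by (simp only: powr_powr inv) simp
    also have "\<dots> \<le> T"
      unfolding T_def using \<delta> k \<beta> by (intro powr_mono2') (auto simp: field_simps)
    finally show "integral {\<delta>..k * ?\<rho> powr - ?\<beta>} (\<lambda>\<tau>. \<mu> \<tau> / \<tau>) \<le> ?\<beta> / ((?p - 1) * c) * I powr (1 - ?p)"
      using bound[of T] unfolding T\<delta> by simp
  qed auto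
qed

lemma supp_subset_ball_imp_zero:
  fixes f :: "'a::real_normed_vector \<Rightarrow> real"
  assumes "supp f \<subseteq> ball 0 R" "R \<le> norm x"
  shows "f x = 0"
proof (rule ccontr)
  assume "f x \<noteq> 0"
  then have "x \<in> supp f"
    unfolding supp_def support_on_def using closure_subset by fastforce
  with assms show False by auto
qed

theorem theorem2p1:
  fixes u\<^sub>0 u\<^sub>1 :: "real ^ 'n \<Rightarrow> real"
    and u :: "real \<Rightarrow> real ^ 'n \<Rightarrow> real"
    and \<mu> :: "real \<Rightarrow> real"
    and \<epsilon> R :: real
    and T\<^sub>\<epsilon> :: ereal
  assumes "CARD('n) \<ge> 2"
    and "\<epsilon> > 0"
    and "R > 0"
    and "C2_on UNIV u\<^sub>0" and "compact (supp u\<^sub>0)" and "supp u\<^sub>0 \<subseteq> ball 0 R"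
    and "C1_on UNIV u\<^sub>1" and "compact (supp u\<^sub>1)" and "supp u\<^sub>1 \<subseteq> ball 0 R"
    and "(\<integral>x. u\<^sub>1 x \<partial>lborel) > 0"
    and "modulus_of_continuity \<mu>"
    and "convex_on UNIV (glassey_nonlinearity CARD('n) \<mu>)"
    and "\<not> dini_condition \<mu>"
    and "has_lifespan (glassey_nonlinearity CARD('n) \<mu>)
           (\<lambda>x. \<epsilon> * u\<^sub>0 x) (\<lambda>x. \<epsilon> * u\<^sub>1 x) u T\<^sub>\<epsilon>"
  shows "T\<^sub>\<epsilon> < \<infinity>"
proof (rule ccontr)
  assume "\<not> T\<^sub>\<epsilon> < \<infinity>"
  then have T: "T\<^sub>\<epsilon> = \<infinity>" by simp
  let ?F = "glassey_nonlinearity CARD('n) \<mu>"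
  have sol: "classical_solution ?F (\<lambda>x. \<epsilon> * u\<^sub>0 x) (\<lambda>x. \<epsilon> * u\<^sub>1 x) \<infinity> u"
    using assms(14) unfolding has_lifespan_def T by blast
  define f where "f = (\<lambda>(t, x). u t x)"
  have set: "{t. 0 \<le> t \<and> ereal t < \<infinity>} = {0::real..}" by auto
  have "C2_on half_space f"
    using sol unfolding classical_solution_def set f_def by blast
  then obtain d dd where C2: "C2_half_space f d dd" using C2_on_half_space_imp by blast
  interpret C2_half_space f d dd by (rule C2)
  have vel: "d (1, 0) (0, x) = \<epsilon> * u\<^sub>1 x" for x
    using sol time_deriv_eq(1)[OF f_def, of 0 x] by (simp add: classical_solution_def)
  interpret wave_solution f d dd ?F R
  proof
    show "dd (1, 0) (1, 0) (t, x) - (\<Sum>i\<in>Basis. dd (0, i) (0, i) (t, x)) = ?F (d (1, 0) (t, x))"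
      if "0 < t" for t x
    proof -
      have "time_deriv (time_deriv u) t x - laplacian (u t) x = ?F (time_deriv u t x)"
        using sol that by (simp add: classical_solution_def)
      then show ?thesis
        using that by (simp only: time_deriv_eq[OF f_def] laplacian_eq[OF f_def] less_imp_le)
    qed
    show "d (1, 0) (0, x) = 0" if "R < norm x" for x
      using supp_subset_ball_imp_zero[OF assms(9), of x] that by (simp add: vel)
    show "f (0, x) = 0" if "R \<le> norm x" for x
      using supp_subset_ball_imp_zero[OF assms(6) that] sol by (simp add: f_def classical_solution_def)
  qed (use assms in \<open>auto intro: glassey_nonneg glassey_linear_bound\<close>)
  have "integrable lborel u\<^sub>1" using assms(10) not_integrable_integral_eq by fastforce
  then have "(u\<^sub>1 has_integral (\<integral>x. u\<^sub>1 x \<partial>lborel)) UNIV" by (rule has_integral_integral_lborel)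
  then have "((\<lambda>x. d (1, 0) (0, x)) has_integral (\<epsilon> * (\<integral>x. u\<^sub>1 x \<partial>lborel))) UNIV"
    unfolding vel by (rule has_integral_mult_right)
  then have "dini_condition \<mu>"
    by (rule dini_condition_of_global_solution[rotated 3]) (use assms in auto)
  then show False using assms(13) by simp
qed

end
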